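(* Let $k\geq 3$, let $r$ be the integer with $2^{r-1}-1<k\leq 2^r-1$, $h=k-r$, and let $A\in\{0,1\}^{h\times k}$ be a matrix whose rows form a basis of a linear code over $\{0,1\}$ of length $k$, dimension $h$ and minimum distance $3$ (Hamming code). Then for any $\epsilon>0$, there exists $d\geq 1$ such that every $(1-2k/2^k-\epsilon)$-tester for CSP($P_A$) with degree bound $d$ requires $\Omega(n)$ queries, where $n$ is the number of variables.
   Context: For $A\in\{0,1\}^{h\times k}$, the predicate $P_A:\{0,1\}^k\to\{0,1\}$ is defined by $P_A(x)=1$ iff $A\cdot x^T=0$ over $\mathrm{GF}(2)$. A linear code of length $k$ and distance 3 over $\{0,1\}$ is a subspace of $\{0,1\}^k$ in which every nonzero vector has at least 3 nonzero entries. An instance of CSP($P_A$) consists of Boolean variables and constraints, each on a $k$-tuple $(x_1,\dots,x_k)$ and of the form $P_A(x_1+b_1,\dots,x_k+b_k)=1$ for some $b\in\{0,1\}^k$. Bounded-degree model with degree bound $d$: each variable appears in at most $d$ constraints; an algorithm accesses the instance only via an oracle that, given a variable $x$ and an index $1\le i\le d$, returns the $i$-th constraint containing $x$ (or a special symbol if none exists); query complexity is the number of oracle calls. An instance is $\epsilon$-far from satisfiability if at least $\epsilon dn/k$ constraints must be removed to make it satisfiable. An $\epsilon$-tester is a randomized algorithm that accepts every satisfiable instance with probability at least $2/3$ and rejects every instance $\epsilon$-far from satisfiability with probability at least $2/3$. *)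

theory Defs
  imports "HOL-Probability.Probability" "HOL-Library.Z2"
begin

text \<open>
  The field GF(2) is the type \<^typ>\<open>bit\<close>; a row vector of length \<open>k\<close> over it has type
  \<open>bit ^ 'k\<close> with \<open>CARD('k) = k\<close>.
\<close>

definition linear_code :: "nat \<Rightarrow> (bit ^ 'k) set \<Rightarrow> bool" where
  "linear_code \<delta> C \<longleftrightarrow>
     vec.subspace C \<and> (\<forall>x\<in>C. x \<noteq> 0 \<longrightarrow> card {j. x $ j \<noteq> 0} \<ge> \<delta>)"

definition pred :: "bit ^ 'k ^ 'h \<Rightarrow> bit ^ 'k \<Rightarrow> bool" where
  "pred A x \<longleftrightarrow> A *v x = 0"


text \<open>
  The variables of an instance on \<open>n\<close> variables are the numbers below \<open>n\<close>. A constraint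
  \<open>(v, b)\<close> stands for \<open>P(v\<^sub>1 + b\<^sub>1, \<dots>, v\<^sub>k + b\<^sub>k) = 1\<close>.
\<close>

type_synonym 'k constraint = "(nat ^ 'k) \<times> (bit ^ 'k)"

definition constraint_vars :: "('k::finite) constraint \<Rightarrow> nat set" where
  "constraint_vars c = {fst c $ j |j. True}"

definition holds :: "bit ^ 'k ^ 'h \<Rightarrow> (nat \<Rightarrow> bit) \<Rightarrow> 'k constraint \<Rightarrow> bool" where
  "holds A \<sigma> c \<longleftrightarrow> pred A (\<chi> j. \<sigma> (fst c $ j) + snd c $ j)"

definition satisfiable :: "bit ^ 'k ^ 'h \<Rightarrow> 'k constraint set \<Rightarrow> bool" where
  "satisfiable A Cs \<longleftrightarrow> (\<exists>\<sigma>. \<forall>c\<in>Cs. holds A \<sigma> c)"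

text \<open>
  An instance comes with an arbitrary enumeration, for each variable, of the constraints
  containing that variable; this enumeration determines how queries are answered.
\<close>

record ('k::finite) csp =
  constraints :: "'k constraint set"
  incidence :: "nat \<Rightarrow> 'k constraint list"

definition bounded_degree_instance :: "nat \<Rightarrow> nat \<Rightarrow> ('k::finite) csp \<Rightarrow> bool" where
  "bounded_degree_instance d n I \<longleftrightarrow>
     finite (constraints I) \<and>
     (\<forall>c\<in>constraints I. constraint_vars c \<subseteq> {..<n}) \<and>
     (\<forall>x. card {c \<in> constraints I. x \<in> constraint_vars c} \<le> d) \<and>
     (\<forall>x. distinct (incidence I x) \<and>
          set (incidence I x) = {c \<in> constraints I. x \<in> constraint_vars c})"

definition csp_oracle :: "('k::finite) csp \<Rightarrow> nat \<Rightarrow> nat \<Rightarrow> 'k constraint option" where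
  "csp_oracle I x i =
     (if 1 \<le> i \<and> i \<le> length (incidence I x) then Some (incidence I x ! (i - 1)) else None)"

definition far_from_satisfiable ::
    "bit ^ 'k ^ 'h \<Rightarrow> nat \<Rightarrow> nat \<Rightarrow> real \<Rightarrow> 'k csp \<Rightarrow> bool" where
  "far_from_satisfiable A d n \<epsilon> I \<longleftrightarrow>
     (\<forall>R. R \<subseteq> constraints I \<and> satisfiable A (constraints I - R) \<longrightarrow>
          real (card R) \<ge> \<epsilon> * real d * real n / real CARD('k))"


text \<open>
  A deterministic adaptive query algorithm is a decision tree whose inner nodes query a
  variable and an index and branch on the answer. A randomized algorithm is a
  probability distribution over such trees; it may depend on the number of variables
  without any uniformity or running time restriction.
\<close>

datatype 'a dtree = Output bool | Query nat nat "'a \<Rightarrow> 'a dtree"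

primrec accepts :: "'a dtree \<Rightarrow> (nat \<Rightarrow> nat \<Rightarrow> 'a) \<Rightarrow> bool" where
  "accepts (Output a) f = a"
| "accepts (Query x i t) f = accepts (t (f x i)) f"

primrec num_queries :: "'a dtree \<Rightarrow> (nat \<Rightarrow> nat \<Rightarrow> 'a) \<Rightarrow> nat" where
  "num_queries (Output a) f = 0"
| "num_queries (Query x i t) f = Suc (num_queries (t (f x i)) f)"

type_synonym 'k algorithm = "'k constraint option dtree pmf"

text \<open>
  The case \<open>n = 0\<close> has to be excluded: the empty instance would be both satisfiable and
  far from satisfiability, so that no tester would exist.
\<close>

definition tester :: "bit ^ 'k ^ 'h \<Rightarrow> nat \<Rightarrow> real \<Rightarrow> (nat \<Rightarrow> 'k algorithm) \<Rightarrow> bool" where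
  "tester A d \<epsilon> T \<longleftrightarrow>
     (\<forall>n\<ge>1. \<forall>I. bounded_degree_instance d n I \<longrightarrow>
        (satisfiable A (constraints I) \<longrightarrow>
           measure_pmf.prob (T n) {t. accepts t (csp_oracle I)} \<ge> 2 / 3) \<and>
        (far_from_satisfiable A d n \<epsilon> I \<longrightarrow>
           measure_pmf.prob (T n) {t. \<not> accepts t (csp_oracle I)} \<ge> 2 / 3))"

text \<open>
  Worst case over the instances on \<open>n\<close> variables and over the internal randomness; the value
  is \<open>\<infinity>\<close> if the number of queries is unbounded.
\<close>

definition query_complexity :: "nat \<Rightarrow> nat \<Rightarrow> ('k::finite) algorithm \<Rightarrow> enat" where
  "query_complexity d n M =
     (SUP I \<in> {I. bounded_degree_instance d n I}. SUP t \<in> set_pmf M.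
        enat (num_queries t (csp_oracle I)))"

end

theory Submission
  imports Defs "HOL-Combinatorics.Permutations"
begin

text \<open>
  A random \<open>d\<close>-regular arrangement of the variables into constraint scopes expands with
  positive probability: in no
  set of at most \<open>\<delta> n\<close> scopes can one select at least three positions per scope so that every
  selected variable is selected twice. As nonzero codewords have weight at least 3, the
  GF(2)-equations of any \<open>\<delta> n\<close> constraints on such scopes are then linearly independent.
  Hence a uniformly random choice of shifts and a uniformly random choice among the shifts that
  make the instance satisfiable agree on any \<open>\<delta> n\<close> constraints, and an algorithm with that few
  queries cannot tell them apart. But \<open>P\<^sub>A\<close> has \<open>2\<^sup>r \<le> 2k\<close> satisfying inputs, so uniformly random
  shifts give an instance that is far from satisfiable, once \<open>d\<close> is large, by a Chernoff bound
  and a union bound over the assignments.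
\<close>

subsection \<open>Expanding constraint scopes\<close>

text \<open>Divided by \<open>fact (card X)\<close>, the bound compares a random permutation with
  independent uniform values. By induction on \<open>F\<close>: the value at a fresh point avoids
  the \<open>t\<close> points of \<open>W\<close> already taken, so it lies in \<open>W\<close> with
  conditional probability \<open>(w - t) / (N - t) \<le> w / N\<close>.\<close>

lemma card_permutes_image_subset:
  assumes "finite X" and "F \<subseteq> X" and "W \<subseteq> X"
  shows "card {p. p permutes X \<and> p ` F \<subseteq> W} * card X ^ card F \<le> fact (card X) * card W ^ card F"
proof -
  have "finite F" using assms finite_subset by blast
  then show ?thesis using \<open>F \<subseteq> X\<close>
  proof (induction F rule: finite_induct)
    case empty
    then show ?case using card_permutations[OF refl \<open>finite X\<close>] by simp
  next
    case (insert f F)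
    define N where "N = card X"
    define w where "w = card W"
    define t where "t = card F"
    define P where "P = {p. p permutes X \<and> p ` F \<subseteq> W}"
    define P' where "P' = {p. p permutes X \<and> p ` insert f F \<subseteq> W}"
    \<comment> \<open>Composition with the transposition of \<open>f\<close> and \<open>g\<close>
      carries the value at \<open>g\<close> to \<open>f\<close> and keeps the values on
      \<open>F\<close>. As an involution it matches \<open>B\<close> with
      \<open>P' \<times> (X - F)\<close>, the case \<open>g = f\<close> included.\<close>
    define B where "B = (SIGMA p:P. {g\<in>X - F. p g \<in> W})"
    have f: "f \<in> X" "f \<notin> F" "F \<subseteq> X" using insert by auto
    have finP: "finite P" "finite P'"
      unfolding P_def P'_def by (auto intro: finite_subset[OF _ finite_permutations[OF \<open>finite X\<close>]])
    have finW: "finite W" using assms finite_subset by blast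
    let ?h = "\<lambda>(p, g). (p \<circ> Transposition.transpose f g, g)"
    have "card B = card (P' \<times> (X - F))"
    proof (rule bij_betw_same_card, rule bij_betw_byWitness[where f = ?h and f' = ?h])
      have perm: "(p \<circ> Transposition.transpose f g) permutes X" if "p permutes X" "g \<in> X" for p g
        using that f(1) by (intro permutes_compose permutes_swap_id)
      have tr: "Transposition.transpose f g x = x" if "g \<notin> F" "x \<in> F" for g x
        using that f(2) by (auto simp: Transposition.transpose_def)
      show "\<forall>a\<in>B. ?h (?h a) = a" "\<forall>a\<in>P' \<times> (X - F). ?h (?h a) = a"
        by (auto simp: fun_eq_iff)
      show "?h ` B \<subseteq> P' \<times> (X - F)"
        using perm tr by (auto simp: B_def P_def P'_def simp del: comp_apply) (auto simp: image_subset_iff)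
      show "?h ` (P' \<times> (X - F)) \<subseteq> B"
        using perm tr by (auto simp: B_def P_def P'_def simp del: comp_apply) (auto simp: image_subset_iff)
    qed
    also have "\<dots> = card P' * (N - t)"
      using f \<open>finite F\<close> by (simp add: card_cartesian_product N_def t_def card_Diff_subset)
    finally have "card P' * (N - t) = card B" by simp
    also have "\<dots> = (\<Sum>p\<in>P. card {g\<in>X - F. p g \<in> W})"
      unfolding B_def using finP assms by (intro card_SigmaI) auto
    also have "\<dots> \<le> (\<Sum>p\<in>P. w - t)"
    proof (rule sum_mono)
      fix p assume p: "p \<in> P"
      then have inj: "inj p" by (auto simp: P_def permutes_inj)
      have "card {g\<in>X - F. p g \<in> W} = card (p ` {g\<in>X - F. p g \<in> W})"
        using inj by (intro card_image[symmetric]) (auto intro: inj_on_subset)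
      also have "\<dots> \<le> card (W - p ` F)"
        using inj finW by (intro card_mono) (auto simp: inj_def)
      also have "\<dots> = w - t"
        using p finW inj unfolding w_def t_def
        by (subst card_Diff_subset) (auto simp: P_def card_image inj_on_subset finite_subset[OF _ finW])
      finally show "card {g\<in>X - F. p g \<in> W} \<le> w - t" .
    qed
    finally have le: "card P' * (N - t) \<le> card P * (w - t)" by simp
    have "insert f F \<subseteq> X" using f by auto
    then have "card (insert f F) \<le> N" unfolding N_def using \<open>finite X\<close> by (rule card_mono[rotated])
    then have tN: "t < N" using f(2) \<open>finite F\<close> by (simp add: t_def)
    have wN: "w \<le> N" unfolding w_def N_def using assms by (intro card_mono)
    \<comment> \<open>For \<open>t > w\<close> truncated subtraction makes the left side 0;
      otherwise the inequality amounts to \<open>t * w \<le> t * N\<close>.\<close>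
    have wt: "(w - t) * N \<le> w * (N - t)"
    proof (cases "t \<le> w")
      case True
      then show ?thesis using tN wN mult_le_mono1[OF wN, of t] by (simp add: diff_mult_distrib diff_mult_distrib2 mult.commute diff_le_mono2)
    qed simp
    have "(card P' * N) * (N - t) \<le> (card P * w) * (N - t)"
    proof -
      have "(card P' * N) * (N - t) \<le> card P * ((w - t) * N)"
        using mult_le_mono1[OF le, of N] by (simp add: mult.assoc mult.left_commute mult.commute)
      also have "\<dots> \<le> card P * (w * (N - t))" using wt by simp
      finally show ?thesis by (simp add: mult.assoc)
    qed
    then have "card P' * N \<le> card P * w" using tN by simp
    then have "card P' * N * N ^ t \<le> card P * w * N ^ t" by simp
    also have "\<dots> = (card P * N ^ t) * w" by simp
    also have "\<dots> \<le> (fact N * w ^ t) * w"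
      using insert.IH f by (intro mult_le_mono1) (simp add: P_def N_def t_def w_def)
    finally show ?case
      using f(2) \<open>finite F\<close> by (simp add: P'_def N_def t_def w_def algebra_simps)
  qed
qed

text \<open>\<open>n choose v\<close> times \<open>v!\<close> is at most \<open>n ^ v\<close>, and
  \<open>v ^ v / v!\<close> is a single term of the power series of \<open>exp v\<close>.\<close>

lemma binomial_le_exp_power:
  assumes "v > 0" and "n > 0"
  shows "real (n choose v) \<le> exp v * (real n / real v) ^ v"
proof -
  have "real (n choose v) * fact v \<le> real n ^ v"
    using binomial_fact_pow[of n v] by (metis of_nat_fact of_nat_le_iff of_nat_mult of_nat_power)
  moreover have "real v ^ v / fact v \<le> exp v"
  proof -
    have "(\<lambda>i. real v ^ i / fact i) sums exp v"
      using exp_converges[of "real v"] by (simp add: divide_inverse mult.commute)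
    then show ?thesis
      using sum_le_suminf[of "\<lambda>i. real v ^ i / fact i" "{v}"] by (simp add: sums_iff)
  qed
  then have "real v ^ v \<le> exp v * fact v" by (simp add: field_simps)
  ultimately have "(real (n choose v) * fact v) * real v ^ v \<le> real n ^ v * (exp v * fact v)"
    by (intro mult_mono) auto
  then have "real (n choose v) * real v ^ v \<le> exp v * real n ^ v"
    by (simp add: mult.assoc mult.left_commute mult.commute)
  then show ?thesis using assms by (simp add: field_simps power_divide)
qed

lemma card_UN_le_mult:
  assumes "finite I" and "\<And>i. i \<in> I \<Longrightarrow> real (card (B i)) \<le> c"
  shows "real (card (\<Union>i\<in>I. B i)) \<le> real (card I) * c"
proof -
  have "real (card (\<Union>i\<in>I. B i)) \<le> (\<Sum>i\<in>I. real (card (B i)))"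
    using card_UN_le[OF assms(1), of B] by (metis of_nat_le_iff of_nat_sum)
  also have "\<dots> \<le> real (card I) * c" using assms(2) by (intro sum_bounded_above) auto
  finally show ?thesis .
qed

text \<open>Here \<open>s\<close> counts scopes, \<open>t\<close> selected positions and
  \<open>t div 2\<close> variables. The binomial estimate cancels \<open>t div 2\<close> of the
  \<open>t\<close> factors; at least \<open>3 * s / 2\<close> remain, each at most
  \<open>(k * sqrt (s / n)) ^ 2\<close>. The excess of 3/2 over 1 later beats the number of choices
  of \<open>s\<close> scopes.\<close>

lemma choose_half_mult_power_le:
  fixes k n s t :: nat
  assumes "s \<ge> 1" "n \<ge> 1" "3 * s \<le> t" "t \<le> k * s" and "real k * sqrt (s / n) \<le> 1"
  shows "real (n choose (t div 2)) * (real (t div 2) / n) ^ t \<le> (exp k * (k * sqrt (s / n)) ^ 3) ^ s"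
proof -
  define v where "v = t div 2"
  have v: "v \<ge> 1" "v \<le> t" "3 * s \<le> 2 * (t - v)" "v \<le> k * s" using assms by (auto simp: v_def)
  have k1: "k \<ge> 1" using assms by (cases k) auto
  define y where "y = real k * sqrt (s / n)"
  have y: "0 \<le> y" "y \<le> 1" using assms by (auto simp: y_def)
  have "real (n choose v) * (real v / n) ^ t = real (n choose v) * (real v / n) ^ v * (real v / n) ^ (t - v)"
    using v by (simp flip: power_add)
  also have "\<dots> \<le> exp v * (real n / real v) ^ v * (real v / n) ^ v * (real v / n) ^ (t - v)"
    using v assms by (intro mult_right_mono binomial_le_exp_power) auto
  also have "\<dots> = exp v * (real v / n) ^ (t - v)"
    using v assms by (simp add: field_simps flip: power_mult_distrib)
  also have "\<dots> \<le> exp (k * s) * (y ^ 2) ^ (t - v)"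
  proof (intro mult_mono power_mono)
    have "real v \<le> real k * real s" using v(4) by (simp flip: of_nat_mult)
    also have "\<dots> \<le> real k ^ 2 * real s"
      using k1 by (intro mult_right_mono) (auto simp: power2_eq_square)
    finally show "real v / n \<le> y ^ 2"
      using assms by (simp add: y_def power_mult_distrib divide_right_mono)
    show "exp (real v) \<le> exp (k * s)" using v(4) by (simp flip: of_nat_mult)
  qed (use v in auto)
  also have "(y ^ 2) ^ (t - v) = y ^ (2 * (t - v))" by (simp add: power_mult)
  also have "exp (k * s) * \<dots> \<le> exp (k * s) * y ^ (3 * s)"
    using y v by (intro mult_left_mono power_decreasing) auto
  also have "\<dots> = (exp k * y ^ 3) ^ s"
    using exp_of_nat_mult[of s "real k"]
    by (simp add: power_mult_distrib mult.commute flip: power_mult)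
  finally show ?thesis by (simp add: v_def y_def)
qed

text \<open>First-moment argument. Elements of \<open>{..<n} \<times> {..<D}\<close> name scopes,
  \<open>(e, j)\<close> is position \<open>j\<close> of scope \<open>e\<close>, and
  \<open>fst (fst (p (e, j)))\<close> is the variable put there; thus every variable fills
  \<open>D * CARD('k)\<close> positions. It is essential that \<open>\<delta>\<close> does not
  depend on \<open>n\<close>.\<close>

lemma exists_expanding_permutation:
  fixes D :: nat
  assumes "D \<ge> 1"
  obtains \<delta> :: real where "\<delta> > 0"
    and "\<And>n. n \<ge> 1 \<Longrightarrow> \<exists>p. p permutes ({..<n} \<times> {..<D}) \<times> (UNIV :: 'k::finite set) \<and>
          (\<forall>F \<subseteq> ({..<n} \<times> {..<D}) \<times> UNIV. F \<noteq> {} \<and> 3 * card (fst ` F) \<le> card F \<and>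
            real (card (fst ` F)) \<le> \<delta> * real n \<longrightarrow> card F < 2 * card ((fst \<circ> fst \<circ> p) ` F))"
proof -
  define k where "k = CARD('k)"
  have k1: "k \<ge> 1" using finite_UNIV_card_ge_0[where 'a='k] by (simp add: k_def Suc_le_eq)
  \<comment> \<open>The factors come from choosing the scopes (\<open>exp 1 * D\<close>), the
    positions (\<open>2 ^ k\<close>) and the variables (\<open>exp k * k ^ 3\<close>).\<close>
  define K :: real where "K = exp 1 * D * 2 ^ k * exp k * k ^ 3"
  have "1 * 1 * 1 * 1 * real k \<le> K"
    unfolding K_def using assms k1 by (intro mult_mono) (auto simp: self_le_power)
  then have Kk: "real k \<le> K" by simp
  then have K: "K \<ge> 1" using k1 by linarith
  \<comment> \<open>Then \<open>K * sqrt \<delta> = 1 / 2\<close>, so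
    \<open>s \<le> \<delta> * n\<close> gives \<open>K * sqrt (s / n) \<le> 1 / 2\<close>.\<close>
  define \<delta> where "\<delta> = (1 / (2 * K)) ^ 2"
  have "\<exists>p. p permutes ({..<n} \<times> {..<D}) \<times> (UNIV :: 'k::finite set) \<and>
          (\<forall>F \<subseteq> ({..<n} \<times> {..<D}) \<times> UNIV. F \<noteq> {} \<and> 3 * card (fst ` F) \<le> card F \<and>
            real (card (fst ` F)) \<le> \<delta> * real n \<longrightarrow> card F < 2 * card ((fst \<circ> fst \<circ> p) ` F))"
    if n: "n \<ge> 1" for n
  proof (rule ccontr)
    assume contr: "\<not> ?thesis"
    define E where "E = {..<n} \<times> {..<D}"
    define X where "X = E \<times> (UNIV :: 'k set)"
    define M where "M = nat \<lfloor>\<delta> * n\<rfloor>"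
    define Q where "Q F V = {p. p permutes X \<and> p ` F \<subseteq> (V \<times> {..<D}) \<times> UNIV}" for F :: "((nat \<times> nat) \<times> 'k) set" and V
    have fin: "finite E" "finite X" by (auto simp: E_def X_def)
    have cX: "card X = n * (D * k)" by (simp add: X_def E_def k_def card_cartesian_product)
    have cE: "card E = n * D" by (simp add: E_def card_cartesian_product)
    have cQ: "real (card (Q F V)) \<le> fact (card X) * (real (card V) / n) ^ card F"
      if "F \<subseteq> X" "V \<subseteq> {..<n}" for F V
    proof -
      have "card (Q F V) * (n * (D * k)) ^ card F \<le> fact (card X) * (card V * (D * k)) ^ card F"
      proof -
        have W: "(V \<times> {..<D}) \<times> UNIV \<subseteq> X" using that(2) by (auto simp: X_def E_def)
        have "card ((V \<times> {..<D}) \<times> (UNIV :: 'k set)) = card V * (D * k)"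
          by (simp add: card_cartesian_product k_def)
        then show ?thesis
          using card_permutes_image_subset[OF fin(2) that(1) W] unfolding Q_def cX[symmetric] by simp
      qed
      then have "real (card (Q F V)) * (real n * (real D * real k)) ^ card F
          \<le> fact (card X) * (real (card V) * (real D * real k)) ^ card F"
        by (metis (no_types, lifting) of_nat_le_iff of_nat_mult of_nat_power of_nat_fact)
      then have "(real (card (Q F V)) * real n ^ card F) * (real D * real k) ^ card F
          \<le> (fact (card X) * real (card V) ^ card F) * (real D * real k) ^ card F"
        by (simp add: power_mult_distrib mult.assoc)
      then have "real (card (Q F V)) * real n ^ card F \<le> fact (card X) * real (card V) ^ card F"
        using assms k1 by (subst (asm) mult_le_cancel_right_pos) auto
      then show ?thesis using n by (simp add: power_divide field_simps)
    qed
    \<comment> \<open>Union bound over \<open>s\<close> scopes \<open>S\<close>, positions \<open>F\<close> in these scopes, and a set \<open>V\<close> of half as many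
      variables containing the image of \<open>F\<close>. The events for a given \<open>s\<close> have total probability at
      most \<open>(K \<surd>(s/n))\<^sup>s \<le> 2\<^sup>-\<^sup>s\<close>.\<close>
    define BF where "BF F = (\<Union>V\<in>{V. V \<subseteq> {..<n} \<and> card V = card F div 2}. Q F V)" for F
    define BS where "BS s S = (\<Union>F\<in>{F. F \<subseteq> S \<times> UNIV \<and> 3 * s \<le> card F}. BF F)" for s S
    define B where "B s = (\<Union>S\<in>{S. S \<subseteq> E \<and> card S = s}. BS s S)" for s
    have cB: "real (card (B s)) \<le> fact (card X) * (1 / 2) ^ s" if s: "1 \<le> s" "s \<le> M" for s
    proof -
      define u where "u = sqrt (real s / n)"
      define z where "z = exp (real k) * (real k * u) ^ 3"
      have "real s \<le> real M" using s by simp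
      also have "real M \<le> \<delta> * n" unfolding M_def \<delta>_def by (simp add: of_nat_floor)
      finally have "real s / n \<le> \<delta>" using n by (simp add: field_simps)
      then have "u \<le> sqrt \<delta>" by (simp add: u_def)
      also have "sqrt \<delta> = 1 / (2 * K)" using K by (simp add: \<delta>_def)
      finally have Ku: "K * u \<le> 1 / 2" using K by (simp add: field_simps)
      have u: "u > 0" using s n by (simp add: u_def)
      have "real k * u \<le> K * u" using Kk u by simp
      then have ku: "real k * u \<le> 1" using Ku by linarith
      have z: "z \<ge> 0" using u by (simp add: z_def)
      have "real (card (BF F)) \<le> fact (card X) * z ^ s"
        if S: "S \<subseteq> E" "card S = s" and F: "F \<subseteq> S \<times> UNIV" "3 * s \<le> card F" for S F
      proof -
        have finS: "finite S" using S fin finite_subset by blast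
        have "card F \<le> card (S \<times> (UNIV :: 'k set))" using F finS by (intro card_mono) auto
        then have Fk: "card F \<le> k * s" using S by (simp add: card_cartesian_product k_def mult.commute)
        have "real (card (BF F)) \<le> real (card {V. V \<subseteq> {..<n} \<and> card V = card F div 2}) *
            (fact (card X) * (real (card F div 2) / n) ^ card F)"
          unfolding BF_def
        proof (rule card_UN_le_mult)
          fix V assume "V \<in> {V. V \<subseteq> {..<n} \<and> card V = card F div 2}"
          then show "real (card (Q F V)) \<le> fact (card X) * (real (card F div 2) / n) ^ card F"
            using cQ[of F V] F S unfolding X_def by auto
        qed auto
        also have "card {V. V \<subseteq> {..<n} \<and> card V = card F div 2} = n choose (card F div 2)"
          using n_subsets[of "{..<n}"] by simp
        also have "real (n choose (card F div 2)) * (fact (card X) * (real (card F div 2) / n) ^ card F)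
            = fact (card X) * (real (n choose (card F div 2)) * (real (card F div 2) / n) ^ card F)"
          by simp
        also have "\<dots> \<le> fact (card X) * z ^ s"
          unfolding z_def u_def using s n F(2) Fk ku
          by (intro mult_left_mono choose_half_mult_power_le) (auto simp: u_def)
        finally show ?thesis .
      qed note cBF = this
      have cBS: "real (card (BS s S)) \<le> 2 ^ (k * s) * (fact (card X) * z ^ s)"
        if S: "S \<subseteq> E" "card S = s" for S
      proof -
        have finS: "finite S" using S fin finite_subset by blast
        have "real (card (BS s S)) \<le> real (card {F. F \<subseteq> S \<times> (UNIV :: 'k set) \<and> 3 * s \<le> card F}) * (fact (card X) * z ^ s)"
          unfolding BS_def using cBF[OF S] finS by (intro card_UN_le_mult) auto
        also have "\<dots> \<le> 2 ^ (k * s) * (fact (card X) * z ^ s)"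
        proof (rule mult_right_mono)
          have "card {F. F \<subseteq> S \<times> (UNIV :: 'k set) \<and> 3 * s \<le> card F} \<le> card (Pow (S \<times> (UNIV :: 'k set)))"
            using finS by (intro card_mono) auto
          also have "\<dots> = 2 ^ (k * s)"
            using finS S by (simp add: card_Pow card_cartesian_product k_def mult.commute)
          finally show "real (card {F. F \<subseteq> S \<times> (UNIV :: 'k set) \<and> 3 * s \<le> card F}) \<le> 2 ^ (k * s)"
            by (simp only: of_nat_le_numeral_power_cancel_iff)
        qed (use z in auto)
        finally show ?thesis .
      qed
      have "real (card (B s)) \<le> real (card {S. S \<subseteq> E \<and> card S = s}) * (2 ^ (k * s) * (fact (card X) * z ^ s))"
        unfolding B_def using cBS fin by (intro card_UN_le_mult) auto
      also have "card {S. S \<subseteq> E \<and> card S = s} = (n * D) choose s"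
        using n_subsets[OF fin(1)] cE by simp
      also have "real ((n * D) choose s) * (2 ^ (k * s) * (fact (card X) * z ^ s))
          \<le> (exp s * (real (n * D) / real s) ^ s) * (2 ^ (k * s) * (fact (card X) * z ^ s))"
        using z s n assms by (intro mult_right_mono binomial_le_exp_power) auto
      also have "\<dots> = fact (card X) * (exp 1 * (real (n * D) / real s) * (2 ^ k * z)) ^ s"
        using exp_of_nat_mult[of s "1::real"] by (simp add: power_mult_distrib power_mult power_divide)
      \<comment> \<open>The \<open>n / s\<close> from the choice of scopes absorbs two of the three
        factors \<open>u\<close> in \<open>z\<close>; the surviving one keeps the bound
        small.\<close>
      also have "exp 1 * (real (n * D) / real s) * (2 ^ k * z) = K * u"
      proof -
        have "u ^ 2 = real s / n" using s n by (simp add: u_def)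
        then have *: "u ^ 3 * n = u * s" using n by (simp add: power3_eq_cube power2_eq_square field_simps)
        have "exp 1 * (real (n * D) / real s) * (2 ^ k * z)
            = exp 1 * D * 2 ^ k * exp k * k ^ 3 * (u ^ 3 * n) / s"
          by (simp add: z_def power_mult_distrib)
        also have "\<dots> = K * u" unfolding * K_def using s by simp
        finally show ?thesis .
      qed
      also have "fact (card X) * (K * u) ^ s \<le> fact (card X) * (1 / 2) ^ s"
        using Ku K u by (intro mult_left_mono power_mono) auto
      finally show ?thesis .
    qed
    have "{p. p permutes X} \<subseteq> (\<Union>s\<in>{1..M}. B s)"
    proof
      fix p assume "p \<in> {p. p permutes X}"
      then have p: "p permutes X" by simp
      then obtain F where F: "F \<subseteq> X" "F \<noteq> {}" "3 * card (fst ` F) \<le> card F"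
        "real (card (fst ` F)) \<le> \<delta> * real n" and V: "2 * card ((fst \<circ> fst \<circ> p) ` F) \<le> card F"
        using contr unfolding X_def E_def by (meson not_less)
      have finF: "finite F" using F fin finite_subset by blast
      define s where "s = card (fst ` F)"
      have s: "s \<in> {1..M}"
        using F finF by (auto simp: s_def M_def Suc_le_eq card_gt_0_iff le_nat_floor)
      have pF: "p ` F \<subseteq> X" using p F by (metis image_mono permutes_image)
      then have V1: "(fst \<circ> fst \<circ> p) ` F \<subseteq> {..<n}" by (auto simp: X_def E_def)
      \<comment> \<open>\<open>BF\<close> ranges over sets of exactly \<open>card F div 2\<close>
        variables, so the set of variables hit by \<open>F\<close> has to be enlarged; this ensures
        that enough variables exist.\<close>
      have "card F div 2 \<le> card {..<n}"
      proof -
        have "card F \<le> card (fst ` F \<times> (UNIV :: 'k set))"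
          using finF by (intro card_mono) (auto simp: image_iff, force)
        then have "real (card F) \<le> real k * real s"
          by (simp add: card_cartesian_product s_def k_def mult.commute flip: of_nat_mult)
        also have "\<dots> \<le> K * (\<delta> * n)"
          using Kk F(4) by (intro mult_mono) (auto simp: s_def)
        also have "K * (\<delta> * n) \<le> n"
        proof -
          have "K * \<delta> \<le> 1" using K by (simp add: \<delta>_def power2_eq_square field_simps)
          then show ?thesis by (metis mult.assoc mult_left_le_one_le mult_right_mono of_nat_0_le_iff mult_1)
        qed
        finally show ?thesis by simp
      qed
      then obtain V where V: "(fst \<circ> fst \<circ> p) ` F \<subseteq> V" "V \<subseteq> {..<n}" "card V = card F div 2"
      proof -
        have "card ((fst \<circ> fst \<circ> p) ` F) \<le> card F div 2" using V by linarith
        then show thesis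
          using exists_subset_between[OF _ \<open>card F div 2 \<le> card {..<n}\<close> V1] that by blast
      qed
      have "p \<in> Q F V" using p pF V by (auto simp: Q_def X_def E_def) force+
      moreover have "fst ` F \<subseteq> E" "F \<subseteq> fst ` F \<times> UNIV" using F by (auto simp: X_def) force+
      ultimately show "p \<in> (\<Union>s\<in>{1..M}. B s)"
        using s V F(3) unfolding B_def BS_def BF_def s_def by blast
    qed
    then have "card {p. p permutes X} \<le> card (\<Union>s\<in>{1..M}. B s)"
      by (rule card_mono[rotated]) (auto simp: B_def BS_def BF_def Q_def intro: finite_subset[OF _ finite_permutations[OF fin(2)]])
    then have "fact (card X) \<le> real (card (\<Union>s\<in>{1..M}. B s))"
      using card_permutations[OF refl fin(2)] by (metis of_nat_fact of_nat_le_iff)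
    also have "\<dots> \<le> (\<Sum>s\<in>{1..M}. real (card (B s)))"
      using card_UN_le[of "{1..M}" B] by (metis finite_atLeastAtMost of_nat_le_iff of_nat_sum)
    also have "\<dots> \<le> (\<Sum>s\<in>{1..M}. fact (card X) * (1 / 2) ^ s)"
      using cB by (intro sum_mono) auto
    also have "\<dots> = fact (card X) * (\<Sum>s\<in>{1..M}. (1 / 2) ^ s)" by (simp add: sum_distrib_left)
    \<comment> \<open>The geometric sum stays below 1, so the bad events cannot cover all
      permutations.\<close>
    also have "(\<Sum>s\<in>{1..M}. (1 / 2 :: real) ^ s) = 1 - (1 / 2) ^ M"
      by (induction M) auto
    finally have "(1 / 2 :: real) ^ M \<le> 0" by (simp add: mult_le_cancel_left1)
    moreover have "(1 / 2 :: real) ^ M > 0" by simp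
    ultimately show False by (metis not_le)
  qed
  then show thesis using that[of \<delta>] K by (auto simp: \<delta>_def)
qed

subsection \<open>Linear systems over GF(2)\<close>

instance bit :: finite
proof
  have "(UNIV :: bit set) = {0, 1}" using bit.exhaust by auto
  then show "finite (UNIV :: bit set)" by (metis finite.simps)
qed

lemma card_UNIV_bit: "CARD(bit) = 2"
proof -
  have bits: "(UNIV :: bit set) = {0, 1}" using bit.exhaust by auto
  show ?thesis unfolding bits by simp
qed

text \<open>Over GF(2) a linear combination of rows is a subset sum, so the last assumption is
  linear independence of the rows. The proof is Gaussian elimination with pivot \<open>x\<close> in
  row \<open>l0\<close>.\<close>

lemma bit_system_solvable:
  fixes \<rho> :: "'l \<Rightarrow> 'x \<Rightarrow> bit"
  assumes "finite L" and "finite U"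
    and "\<And>T. T \<subseteq> L \<Longrightarrow> T \<noteq> {} \<Longrightarrow> \<exists>x\<in>U. (\<Sum>l\<in>T. \<rho> l x) \<noteq> 0"
  shows "\<exists>\<sigma>. \<forall>l\<in>L. (\<Sum>x\<in>U. \<rho> l x * \<sigma> x) = z l"
  using assms(1,3)
proof (induction L arbitrary: \<rho> z rule: finite_induct)
  case empty
  then show ?case by simp
next
  case (insert l0 L)
  obtain x where x: "x \<in> U" "\<rho> l0 x = 1"
    using insert.prems[of "{l0}"] by auto
  define \<rho>' where "\<rho>' l y = \<rho> l y + \<rho> l x * \<rho> l0 y" for l y
  have "\<exists>y\<in>U. (\<Sum>l\<in>T. \<rho>' l y) \<noteq> 0" if T: "T \<subseteq> L" "T \<noteq> {}" for T
  proof -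
    have eq: "(\<Sum>l\<in>T. \<rho>' l y) = (\<Sum>l\<in>T. \<rho> l y) + (\<Sum>l\<in>T. \<rho> l x) * \<rho> l0 y" for y
      by (simp only: \<rho>'_def sum.distrib sum_distrib_right)
    have T0: "finite T" "l0 \<notin> T" using T insert.hyps finite_subset by auto
    show ?thesis
    \<comment> \<open>A sum of reduced rows over \<open>T\<close> is the sum of the original rows
      over \<open>T\<close> or over \<open>insert l0 T\<close>, according to the parity at
      \<open>x\<close>.\<close>
    proof (cases "(\<Sum>l\<in>T. \<rho> l x) = 0")
      case True
      obtain y where "y \<in> U" "(\<Sum>l\<in>T. \<rho> l y) \<noteq> 0" using insert.prems[of T] T by auto
      then show ?thesis using eq[of y] True by (intro bexI[of _ y]) auto
    next
      case False
      obtain y where y: "y \<in> U" "(\<Sum>l\<in>insert l0 T. \<rho> l y) \<noteq> 0"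
        using insert.prems[of "insert l0 T"] T by auto
      have "(\<Sum>l\<in>T. \<rho>' l y) = (\<Sum>l\<in>insert l0 T. \<rho> l y)"
        using False T0 unfolding eq by (simp add: add.commute del: add_bit_eq_xor)
      then show ?thesis using y by auto
    qed
  qed
  from insert.IH[of \<rho>' "\<lambda>l. z l + \<rho> l x * z l0", OF this]
  obtain \<sigma> where \<sigma>: "(\<Sum>y\<in>U. \<rho>' l y * \<sigma> y) = z l + \<rho> l x * z l0" if "l \<in> L" for l
    by blast
  \<comment> \<open>\<open>c\<close> is the defect of equation \<open>l0\<close>. Changing
    \<open>\<sigma>\<close> at \<open>x\<close> by \<open>c\<close> repairs it and leaves the
    reduced equations intact, because their entries at \<open>x\<close> vanish.\<close>
  define c where "c = z l0 + (\<Sum>y\<in>U. \<rho> l0 y * \<sigma> y)"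
  define \<sigma>' where "\<sigma>' y = \<sigma> y + (if y = x then c else 0)" for y
  have sum': "(\<Sum>y\<in>U. \<rho> l y * \<sigma>' y) = (\<Sum>y\<in>U. \<rho> l y * \<sigma> y) + \<rho> l x * c" for l
  proof -
    have "(\<Sum>y\<in>U. \<rho> l y * \<sigma>' y) = (\<Sum>y\<in>U. \<rho> l y * \<sigma> y + (if y = x then \<rho> l x * c else 0))"
      by (intro sum.cong) (auto simp: \<sigma>'_def distrib_left simp del: add_bit_eq_xor mult_bit_eq_and)
    then show ?thesis using x \<open>finite U\<close> by (simp add: sum.distrib del: add_bit_eq_xor mult_bit_eq_and)
  qed
  have "(\<Sum>y\<in>U. \<rho> l y * \<sigma>' y) = z l" if l: "l \<in> insert l0 L" for l
  proof (cases "l = l0")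
    case True
    define s where "s = (\<Sum>y\<in>U. \<rho> l0 y * \<sigma> y)"
    show ?thesis unfolding True sum' c_def s_def[symmetric] x by (cases s; cases "z l0") simp_all
  next
    case False
    define s where "s = (\<Sum>y\<in>U. \<rho> l0 y * \<sigma> y)"
    define t where "t = (\<Sum>y\<in>U. \<rho> l y * \<sigma> y)"
    have "(\<Sum>y\<in>U. \<rho>' l y * \<sigma> y) = t + \<rho> l x * s"
      by (simp only: \<rho>'_def t_def s_def distrib_right sum.distrib sum_distrib_left mult.assoc)
    then have "t + \<rho> l x * s = z l + \<rho> l x * z l0" using \<sigma>[of l] l False by auto
    then show ?thesis unfolding sum' c_def s_def[symmetric] t_def[symmetric]
      by (cases s; cases t; cases "z l0"; cases "z l"; cases "\<rho> l x") simp_all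
  qed
  then show ?case by blast
qed

text \<open>A vanishing combination of equations yields one codeword per scope. Each nonzero
  codeword occupies at least three positions, and cancellation forces each occurring variable to
  occur at least twice, against \<open>expand\<close>. So the equations are independent, and all
  right-hand sides are attained.\<close>

lemma scopes_system_solvable:
  fixes A :: "bit ^ 'k ^ 'h" and v :: "'e \<Rightarrow> nat ^ 'k"
  assumes code: "linear_code 3 C"
    and indep: "\<And>c. (\<Sum>i\<in>UNIV. c i *s row i A) = 0 \<Longrightarrow> \<forall>i. c i = 0"
    and mem: "\<And>c. (\<Sum>i\<in>UNIV. c i *s row i A) \<in> C"
    and "finite S" and less: "\<And>e j. e \<in> S \<Longrightarrow> v e $ j < n"
    and expand: "\<And>F. F \<subseteq> S \<times> UNIV \<Longrightarrow> F \<noteq> {} \<Longrightarrow> 3 * card (fst ` F) \<le> card F \<Longrightarrow>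
      card F < 2 * card ((\<lambda>(e, j). v e $ j) ` F)"
  shows "\<exists>\<sigma>. \<forall>e\<in>S. A *v (\<chi> j. \<sigma> (v e $ j)) = z e"
proof -
  \<comment> \<open>Equations are indexed by a scope \<open>e\<close> and a row \<open>i\<close>.
    The coefficient of \<open>x\<close> is a sum since a scope may repeat a variable.\<close>
  define \<rho> where "\<rho> = (\<lambda>(e, i) x. \<Sum>j | v e $ j = x. A $ i $ j)"
  have "\<exists>x\<in>{..<n}. (\<Sum>l\<in>T. \<rho> l x) \<noteq> 0" if T: "T \<subseteq> S \<times> UNIV" "T \<noteq> {}" for T
  proof (rule ccontr)
    assume "\<not> ?thesis"
    then have zero: "(\<Sum>l\<in>T. \<rho> l x) = 0" if "x < n" for x using that by auto
    have finT: "finite T" using T \<open>finite S\<close> finite_subset by fastforce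
    define c where "c e i = (of_bool ((e, i) \<in> T) :: bit)" for e i
    define w where "w e = (\<Sum>i\<in>UNIV. c e i *s row i A)" for e
    define F where "F = {(e, j). e \<in> S \<and> w e $ j \<noteq> 0}"
    have F: "F \<subseteq> S \<times> UNIV" by (auto simp: F_def)
    have finF: "finite F" using F \<open>finite S\<close> finite_subset by fastforce
    have FS: "F = (SIGMA e:S. {j. w e $ j \<noteq> 0})" by (auto simp: F_def)
    have weight: "3 \<le> card {j. w e $ j \<noteq> 0}" if "w e \<noteq> 0" for e
      using code mem[of "c e"] that unfolding linear_code_def w_def by auto
    have "3 * card (fst ` F) = (\<Sum>e\<in>fst ` F. 3)" by simp
    also have "\<dots> \<le> (\<Sum>e\<in>fst ` F. card {j. w e $ j \<noteq> 0})"
      by (intro sum_mono weight) (auto simp: F_def)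
    also have "\<dots> \<le> (\<Sum>e\<in>S. card {j. w e $ j \<noteq> 0})"
      using \<open>finite S\<close> F by (intro sum_mono2) auto
    also have "\<dots> = card F" unfolding FS using \<open>finite S\<close> by simp
    finally have F3: "3 * card (fst ` F) \<le> card F" .
    have "F \<noteq> {}"
    proof -
      obtain e i where ei: "(e, i) \<in> T" using T by auto
      then have "w e \<noteq> 0" using indep[of "c e"] by (auto simp: w_def c_def)
      then obtain j where "w e $ j \<noteq> 0" by (auto simp: vec_eq_iff)
      then have "(e, j) \<in> F" using ei T by (auto simp: F_def)
      then show ?thesis by auto
    qed
    define var where "var = (\<lambda>(e, j). v e $ j)"
    have "2 \<le> card {p\<in>F. var p = x}" if x: "x \<in> var ` F" for x
    proof -
      have xn: "x < n" using x less by (auto simp: var_def F_def)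
      have "0 = (\<Sum>l\<in>T. \<rho> l x)" using zero xn by simp
      also have "\<dots> = (\<Sum>(e, i)\<in>S \<times> UNIV. c e i * (\<Sum>j | v e $ j = x. A $ i $ j))"
        using T \<open>finite S\<close> by (intro sum.mono_neutral_cong_left) (auto simp: c_def \<rho>_def simp del: mult_bit_eq_and)
      also have "\<dots> = (\<Sum>e\<in>S. \<Sum>i\<in>UNIV. \<Sum>j | v e $ j = x. c e i * A $ i $ j)"
        by (simp add: sum_distrib_left del: mult_bit_eq_and flip: sum.cartesian_product)
      also have "\<dots> = (\<Sum>e\<in>S. \<Sum>j | v e $ j = x. w e $ j)"
        by (intro sum.cong refl, subst sum.swap)
          (simp add: w_def sum_component row_def del: mult_bit_eq_and)
      also have "\<dots> = (\<Sum>(e, j)\<in>(SIGMA e:S. {j. v e $ j = x}). w e $ j)"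
        using \<open>finite S\<close> by (simp add: sum.Sigma)
      \<comment> \<open>Every nonzero entry is 1, so the sum is the parity of the number of selected
        positions holding \<open>x\<close>.\<close>
      also have "\<dots> = (\<Sum>p\<in>{p\<in>F. var p = x}. 1)"
        using \<open>finite S\<close> by (intro sum.mono_neutral_cong_right) (auto simp: F_def var_def)
      also have "\<dots> = of_nat (card {p\<in>F. var p = x})" by simp
      finally have "even (card {p\<in>F. var p = x})"
        by (metis even_of_nat even_zero)
      moreover have "card {p\<in>F. var p = x} \<noteq> 0" using x finF by auto
      ultimately show ?thesis by presburger
    qed
    then have "(\<Sum>x\<in>var ` F. 2) \<le> (\<Sum>x\<in>var ` F. card {p\<in>F. var p = x})" by (intro sum_mono)
    also have "\<dots> = card F" using sum.group[OF finF _ subset_refl, of var "\<lambda>_. 1::nat"] finF by simp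
    finally have "2 * card (var ` F) \<le> card F" by simp
    then show False using expand[OF F \<open>F \<noteq> {}\<close> F3] by (simp add: var_def)
  qed
  from bit_system_solvable[of "S \<times> UNIV" "{..<n}" \<rho> "\<lambda>(e, i). z e $ i", OF _ _ this]
  obtain \<sigma> where \<sigma>: "(\<Sum>x<n. \<rho> (e, i) x * \<sigma> x) = z e $ i" if "e \<in> S" for e i
    using \<open>finite S\<close> by fastforce
  have "A *v (\<chi> j. \<sigma> (v e $ j)) = z e" if e: "e \<in> S" for e
  proof -
    have "(\<Sum>x<n. \<rho> (e, i) x * \<sigma> x) = (\<Sum>j\<in>UNIV. A $ i $ j * \<sigma> (v e $ j))" for i
    proof -
      have "(\<Sum>x<n. \<rho> (e, i) x * \<sigma> x) = (\<Sum>x<n. \<Sum>j | j \<in> UNIV \<and> v e $ j = x. A $ i $ j * \<sigma> (v e $ j))"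
        by (simp add: \<rho>_def sum_distrib_right del: mult_bit_eq_and)
      also have "\<dots> = (\<Sum>j\<in>UNIV. A $ i $ j * \<sigma> (v e $ j))"
        using less[OF e] by (intro sum.group) auto
      finally show ?thesis .
    qed
    then show ?thesis using \<sigma>[OF e]
      by (simp add: vec_eq_iff matrix_vector_mult_def del: mult_bit_eq_and)
  qed
  then show ?thesis by blast
qed

text \<open>Independence of the set \<open>rows A\<close> does not exclude repeated rows; the
  dimension does, as it forces \<open>CARD('h)\<close> distinct rows. Independence then transfers to
  the indexed family.\<close>

lemma rows_coefficients_zero:
  fixes A :: "'a::field ^ 'k ^ 'h"
  assumes "vec.independent (rows A)" and dim: "vec.dim (vec.span (rows A)) = CARD('h)"
    and c: "(\<Sum>i\<in>UNIV. c i *s row i A) = 0"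
  shows "\<forall>i. c i = 0"
proof -
  have rows: "rows A = range (\<lambda>i. row i A)" by (auto simp: rows_def)
  have "card (rows A) = CARD('h)"
    using dim vec.dim_span_eq_card_independent[OF assms(1)] by simp
  then have inj: "inj (\<lambda>i. row i A)"
    unfolding rows by (intro eq_card_imp_inj_on) auto
  have "finite (rows A)" unfolding rows by simp
  define u where "u x = c (inv (\<lambda>i. row i A) x)" for x
  have u: "u (row i A) = c i" for i by (simp add: u_def inv_f_f[OF inj])
  have "(\<Sum>x\<in>rows A. u x *s x) = (\<Sum>i\<in>UNIV. c i *s row i A)"
    unfolding rows using inj by (simp add: sum.reindex u)
  then have "\<forall>x\<in>rows A. u x = 0"
    using c vec.independentD[OF assms(1) \<open>finite (rows A)\<close> subset_refl, of u] by auto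
  then show ?thesis unfolding rows using u by auto
qed

subsection \<open>Local indistinguishability\<close>

text \<open>Translation by the difference of two members of \<open>Y\<close> maps the fiber over one
  pattern injectively into the fiber over another. So all patterns on \<open>S\<close> occur equally
  often: a uniform member of \<open>Y\<close> is uniform on \<open>S\<close>.\<close>

lemma card_fiber_mult:
  fixes Y :: "('e \<Rightarrow> 'c::{ab_group_add, finite}) set"
  assumes Y: "Y \<subseteq> E \<rightarrow>\<^sub>E UNIV" and "finite E" and "S \<subseteq> E"
    and closed: "\<And>a b c. a \<in> Y \<Longrightarrow> b \<in> Y \<Longrightarrow> c \<in> Y \<Longrightarrow> (\<lambda>e\<in>E. a e - b e + c e) \<in> Y"
    and onto: "\<And>\<beta>. \<exists>b\<in>Y. \<forall>e\<in>S. b e = \<beta> e"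
  shows "card {b\<in>Y. \<forall>e\<in>S. b e = \<beta> e} * CARD('c) ^ card S = card Y"
proof -
  have finS: "finite S" using assms finite_subset by blast
  have finY: "finite Y" using finite_subset[OF Y finite_PiE[OF \<open>finite E\<close>]] by simp
  define R where "R \<gamma> = {b\<in>Y. \<forall>e\<in>S. b e = \<gamma> e}" for \<gamma>
  have le: "card (R \<gamma>) \<le> card (R \<gamma>')" for \<gamma> \<gamma>'
  proof -
    obtain b1 b2 where b: "b1 \<in> Y" "\<forall>e\<in>S. b1 e = \<gamma> e" "b2 \<in> Y" "\<forall>e\<in>S. b2 e = \<gamma>' e"
      using onto by metis
    have "inj_on (\<lambda>a. \<lambda>e\<in>E. a e - b1 e + b2 e) (R \<gamma>)"
    proof (rule inj_onI)
      fix a a' assume a: "a \<in> R \<gamma>" "a' \<in> R \<gamma>"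
        and eq: "(\<lambda>e\<in>E. a e - b1 e + b2 e) = (\<lambda>e\<in>E. a' e - b1 e + b2 e)"
      show "a = a'"
      proof (rule PiE_ext)
        show "a \<in> E \<rightarrow>\<^sub>E UNIV" "a' \<in> E \<rightarrow>\<^sub>E UNIV" using a Y by (auto simp: R_def)
        show "a e = a' e" if "e \<in> E" for e using fun_cong[OF eq, of e] that by simp
      qed
    qed
    moreover have "(\<lambda>a. \<lambda>e\<in>E. a e - b1 e + b2 e) ` R \<gamma> \<subseteq> R \<gamma>'"
      using closed b \<open>S \<subseteq> E\<close> by (auto simp: R_def)
    ultimately show ?thesis using finY by (intro card_inj_on_le) (auto simp: R_def)
  qed
  have "card Y = card (\<Union>\<gamma>\<in>S \<rightarrow>\<^sub>E UNIV. R \<gamma>)"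
  proof (rule arg_cong[where f = card], intro equalityI subsetI)
    fix b assume "b \<in> Y"
    then have "b \<in> R (restrict b S)" by (simp add: R_def)
    moreover have "restrict b S \<in> S \<rightarrow>\<^sub>E UNIV" by auto
    ultimately show "b \<in> (\<Union>\<gamma>\<in>S \<rightarrow>\<^sub>E UNIV. R \<gamma>)" by blast
  qed (auto simp: R_def)
  also have "\<dots> = (\<Sum>\<gamma>\<in>S \<rightarrow>\<^sub>E UNIV. card (R \<gamma>))"
  proof (rule card_UN_disjoint)
    show "\<forall>\<gamma>\<in>S \<rightarrow>\<^sub>E UNIV. \<forall>\<gamma>'\<in>S \<rightarrow>\<^sub>E UNIV. \<gamma> \<noteq> \<gamma>' \<longrightarrow> R \<gamma> \<inter> R \<gamma>' = {}"
      by (fastforce simp: R_def intro: PiE_ext)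
  qed (use finS finY in \<open>auto simp: R_def intro: finite_PiE\<close>)
  also have "\<dots> = (\<Sum>\<gamma>\<in>S \<rightarrow>\<^sub>E (UNIV :: 'c set). card (R \<beta>))"
    using le by (intro sum.cong) (auto intro: antisym)
  also have "\<dots> = card (R \<beta>) * CARD('c) ^ card S"
    using finS by (simp add: card_PiE)
  finally show ?thesis by (simp add: R_def)
qed

text \<open>
  Conditioning on the values already revealed makes the statement provable by induction
  on the tree; \<open>S\<close> is the set of revealed indices.
\<close>
lemma card_accepts_local:
  fixes Y Z :: "('e \<Rightarrow> 'c::finite) set" and g :: "'e \<Rightarrow> 'c \<Rightarrow> 'r"
    and loc :: "nat \<Rightarrow> nat \<Rightarrow> 'e option"
  defines "orc \<equiv> \<lambda>b x i. map_option (\<lambda>e. g e (b e)) (loc x i)"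
  assumes "finite Y" and "finite Z"
    and loc: "\<And>x i e. loc x i = Some e \<Longrightarrow> e \<in> E"
    and eq: "\<And>S \<beta>. S \<subseteq> E \<Longrightarrow> finite S \<Longrightarrow> card S \<le> q \<Longrightarrow>
        card {b\<in>Y. \<forall>e\<in>S. b e = \<beta> e} * card Z = card {b\<in>Z. \<forall>e\<in>S. b e = \<beta> e} * card Y"
    and "S \<subseteq> E" and "finite S"
    and "\<And>b. \<forall>e\<in>S. b e = \<beta> e \<Longrightarrow> num_queries t (orc b) + card S \<le> q"
  shows "card {b\<in>Y. (\<forall>e\<in>S. b e = \<beta> e) \<and> accepts t (orc b)} * card Z =
    card {b\<in>Z. (\<forall>e\<in>S. b e = \<beta> e) \<and> accepts t (orc b)} * card Y"
  using assms(6-)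
proof (induction t arbitrary: S \<beta>)
  case (Output a)
  have "card S \<le> q" using Output.prems(3)[of \<beta>] by simp
  then show ?case using eq[of S \<beta>] Output.prems by (cases a) simp_all
next
  case (Query x i t)
  show ?case
  proof (cases "loc x i")
    case None
    then have orc: "orc b x i = None" for b by (simp add: orc_def)
    have "num_queries (t None) (orc b) + card S \<le> q" if "\<forall>e\<in>S. b e = \<beta> e" for b
      using Query.prems(3)[OF that] by (simp add: orc)
    from Query.IH[OF rangeI Query.prems(1,2) this] show ?thesis by (simp add: orc)
  next
    case (Some e)
    then have orc: "orc b x i = Some (g e (b e))" for b by (simp add: orc_def)
    show ?thesis
    proof (cases "e \<in> S")
      case True
      then have *: "((\<forall>e\<in>S. b e = \<beta> e) \<and> accepts (Query x i t) (orc b)) \<longleftrightarrow>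
          ((\<forall>e\<in>S. b e = \<beta> e) \<and> accepts (t (Some (g e (\<beta> e)))) (orc b))" for b
        by (auto simp: orc)
      have "num_queries (t (Some (g e (\<beta> e)))) (orc b) + card S \<le> q" if "\<forall>e\<in>S. b e = \<beta> e" for b
        using Query.prems(3)[OF that] that True by (simp add: orc)
      from Query.IH[OF rangeI Query.prems(1,2) this] show ?thesis unfolding * .
    next
      case False
      \<comment> \<open>A fresh index splits the count by the revealed value \<open>c\<close>. Each
        branch has one query less and one revealed index more, which keeps within the budget
        \<open>q\<close>.\<close>
      have split: "card {b\<in>W. (\<forall>e\<in>S. b e = \<beta> e) \<and> accepts (Query x i t) (orc b)} =
          (\<Sum>c\<in>UNIV. card {b\<in>W. (\<forall>e'\<in>insert e S. b e' = (\<beta>(e := c)) e') \<and>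
            accepts (t (Some (g e c))) (orc b)})" if "finite W" for W
      proof -
        have "{b\<in>W. (\<forall>e\<in>S. b e = \<beta> e) \<and> accepts (Query x i t) (orc b)} =
          (\<Union>c\<in>UNIV. {b\<in>W. (\<forall>e'\<in>insert e S. b e' = (\<beta>(e := c)) e') \<and>
            accepts (t (Some (g e c))) (orc b)})"
          using False by (auto simp: orc)
        then show ?thesis using that by (simp only:) (intro card_UN_disjoint, auto)
      qed
      have "card {b\<in>Y. (\<forall>e'\<in>insert e S. b e' = (\<beta>(e := c)) e') \<and> accepts (t (Some (g e c))) (orc b)} * card Z
          = card {b\<in>Z. (\<forall>e'\<in>insert e S. b e' = (\<beta>(e := c)) e') \<and> accepts (t (Some (g e c))) (orc b)} * card Y" for c
      proof (rule Query.IH[OF rangeI])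
        fix b assume b: "\<forall>e'\<in>insert e S. b e' = (\<beta>(e := c)) e'"
        then have "\<forall>e\<in>S. b e = \<beta> e" "b e = c" using False by auto
        then show "num_queries (t (Some (g e c))) (orc b) + card (insert e S) \<le> q"
          using Query.prems(3)[of b] False Query.prems(2) by (simp add: orc)
      qed (use Query.prems loc[OF Some] in auto)
      then show ?thesis unfolding split[OF \<open>finite Y\<close>] split[OF \<open>finite Z\<close>] sum_distrib_right by simp
    qed
  qed
qed

text \<open>Linearity of expectation exchanges the average over instances with the internal
  randomness, which reduces claims about \<open>M\<close> to its individual trees.\<close>

lemma sum_prob_eq_expectation_card:
  assumes "finite W"
  shows "(\<Sum>b\<in>W. measure_pmf.prob M {t. P t b}) = measure_pmf.expectation M (\<lambda>t. real (card {b\<in>W. P t b}))"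
proof -
  have "(\<Sum>b\<in>W. measure_pmf.prob M {t. P t b}) = (\<Sum>b\<in>W. measure_pmf.expectation M (indicator {t. P t b}))"
    by simp
  also have "\<dots> = measure_pmf.expectation M (\<lambda>t. \<Sum>b\<in>W. indicator {t. P t b} t)"
    by (intro Bochner_Integration.integral_sum[symmetric] measure_pmf.integrable_const_bound[where B = 1])
      (auto simp: indicator_def)
  also have "(\<lambda>t. \<Sum>b\<in>W. indicator {t. P t b} t :: real) = (\<lambda>t. real (card {b\<in>W. P t b}))"
    using assms by (simp add: indicator_def sum.If_cases Int_def fun_eq_iff)
  finally show ?thesis .
qed

text \<open>Acceptance averages at least 2/3 over \<open>Y\<close> and, by \<open>eq\<close>,
  equally much over \<open>Z\<close>. There it is at most 1/3 outside the exceptional set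
  \<open>B\<close> and at most 1 on \<open>B\<close>, so \<open>B\<close> must make up at least half
  of \<open>Z\<close>.\<close>

lemma satisfiable_and_far_indistinguishable:
  fixes orc :: "'b \<Rightarrow> nat \<Rightarrow> nat \<Rightarrow> 'a" and M :: "'a dtree pmf"
  assumes "finite Y" and "finite Z" and "Y \<noteq> {}"
    and eq: "\<And>t. t \<in> set_pmf M \<Longrightarrow>
      card {b\<in>Y. accepts t (orc b)} * card Z = card {b\<in>Z. accepts t (orc b)} * card Y"
    and acc: "\<And>b. b \<in> Y \<Longrightarrow> measure_pmf.prob M {t. accepts t (orc b)} \<ge> 2 / 3"
    and rej: "\<And>b. b \<in> Z - B \<Longrightarrow> measure_pmf.prob M {t. \<not> accepts t (orc b)} \<ge> 2 / 3"
    and "B \<subseteq> Z"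
  shows "card Z \<le> 2 * card B"
proof -
  define f where "f b = measure_pmf.prob M {t. accepts t (orc b)}" for b
  have swap: "(\<Sum>b\<in>Y. f b) * card Z = (\<Sum>b\<in>Z. f b) * card Y"
  proof -
    have "measure_pmf.expectation M (\<lambda>t. real (card {b\<in>Y. accepts t (orc b)}) * card Z)
      = measure_pmf.expectation M (\<lambda>t. real (card {b\<in>Z. accepts t (orc b)}) * card Y)"
      using eq by (intro integral_cong_AE) (auto simp: AE_measure_pmf_iff simp flip: of_nat_mult)
    then show ?thesis
      unfolding f_def sum_prob_eq_expectation_card[OF \<open>finite Y\<close>] sum_prob_eq_expectation_card[OF \<open>finite Z\<close>]
      by simp
  qed
  have le: "(\<Sum>b\<in>Z. f b) \<le> card Z / 3 + 2 / 3 * card B"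
  proof -
    have "f b \<le> 1 / 3 + (if b \<in> B then 2 / 3 else 0)" if "b \<in> Z" for b
    proof (cases "b \<in> B")
      case False
      have "{t. accepts t (orc b)} = UNIV - {t. \<not> accepts t (orc b)}" by auto
      then have "f b = 1 - measure_pmf.prob M {t. \<not> accepts t (orc b)}"
        unfolding f_def using measure_pmf.prob_compl[of "{t. \<not> accepts t (orc b)}" M] by simp
      then show ?thesis using rej[of b] that False by simp
    qed (simp add: f_def)
    then have "(\<Sum>b\<in>Z. f b) \<le> (\<Sum>b\<in>Z. 1 / 3 + (if b \<in> B then 2 / 3 else 0))" by (intro sum_mono)
    also have "\<dots> = card Z / 3 + 2 / 3 * card B"
      using \<open>finite Z\<close> \<open>B \<subseteq> Z\<close> by (simp add: sum.distrib sum.If_cases Int_absorb1)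
    finally show ?thesis .
  qed
  have "(\<Sum>b\<in>Y. f b) \<ge> (\<Sum>b\<in>Y. 2 / 3)" using acc by (intro sum_mono) (auto simp: f_def)
  then have "2 / 3 * real (card Y) * card Z \<le> (\<Sum>b\<in>Y. f b) * card Z" by (intro mult_right_mono) auto
  also note swap
  also have "(\<Sum>b\<in>Z. f b) * card Y \<le> (card Z / 3 + 2 / 3 * card B) * card Y"
    using le by (intro mult_right_mono) auto
  finally have "(2 / 3 * real (card Z)) * card Y \<le> (card Z / 3 + 2 / 3 * card B) * card Y"
    by (simp add: mult.commute mult.left_commute)
  moreover have "card Y > 0" using assms by (simp add: card_gt_0_iff)
  ultimately have "2 / 3 * real (card Z) \<le> card Z / 3 + 2 / 3 * card B"
    by (subst (asm) mult_le_cancel_right_pos) auto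
  then have "real (card Z) \<le> 2 * card B" by simp
  then show ?thesis by linarith
qed

subsection \<open>Random shifts\<close>

text \<open>
  Markov's inequality for \<open>(1 + \<eta>)\<close> raised to the number of \<open>e\<close> with \<open>b e \<in> K e\<close>,
  where \<open>b\<close> is uniform.
\<close>
lemma dense_choices_exponentially_rare:
  fixes p \<theta> :: real
  assumes "0 \<le> p" and "p < \<theta>"
  obtains \<rho> :: real where "0 < \<rho>" and "\<rho> < 1"
    and "\<And>(E :: 'e set) (K :: 'e \<Rightarrow> 'c::finite set). finite E \<Longrightarrow>
      (\<And>e. e \<in> E \<Longrightarrow> real (card (K e)) = p * CARD('c)) \<Longrightarrow>
      real (card {b \<in> E \<rightarrow>\<^sub>E UNIV. \<theta> * card E < card {e\<in>E. b e \<in> K e}}) \<le> (real CARD('c) * \<rho>) ^ card E"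
proof -
  \<comment> \<open>With this choice \<open>\<theta> * (1 - \<eta>)\<close> is the midpoint of
    \<open>p\<close> and \<open>\<theta>\<close>, so
    \<open>ln (1 + \<eta>) \<ge> \<eta> - \<eta> ^ 2\<close> suffices for
    \<open>1 + p * \<eta> < (1 + \<eta>) powr \<theta>\<close>.\<close>
  define \<eta> where "\<eta> = (\<theta> - p) / (2 * \<theta>)"
  have \<eta>: "0 < \<eta>" "\<eta> \<le> 1" using assms by (auto simp: \<eta>_def field_simps)
  \<comment> \<open>The Markov ratio of one coordinate, mean over threshold; independence of the
    coordinates raises it to the power \<open>card E\<close>.\<close>
  define \<rho> where "\<rho> = (1 + p * \<eta>) / (1 + \<eta>) powr \<theta>"
  have "1 + p * \<eta> \<le> exp (p * \<eta>)" by simp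
  also have "p * \<eta> < \<theta> * (\<eta> - \<eta>\<^sup>2)"
  proof -
    have "\<theta> * \<eta> = (\<theta> - p) / 2" using assms by (simp add: \<eta>_def)
    then have "p < \<theta> - \<theta> * \<eta>" using assms by simp
    then have "p * \<eta> < (\<theta> - \<theta> * \<eta>) * \<eta>" using \<eta> by (intro mult_strict_right_mono)
    then show ?thesis by (simp add: algebra_simps power2_eq_square)
  qed
  also have "\<theta> * (\<eta> - \<eta>\<^sup>2) \<le> \<theta> * ln (1 + \<eta>)"
    using \<eta> assms by (intro mult_left_mono ln_one_plus_pos_lower_bound) auto
  also have "exp (\<theta> * ln (1 + \<eta>)) = (1 + \<eta>) powr \<theta>" using \<eta> by (simp add: powr_def)
  finally have less: "1 + p * \<eta> < (1 + \<eta>) powr \<theta>" by simp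
  have pos: "0 < 1 + p * \<eta>" using assms \<eta> by (simp add: add_pos_nonneg)
  have \<rho>: "0 < \<rho>" "\<rho> < 1" using less pos \<eta> by (auto simp: \<rho>_def divide_less_eq)
  moreover have "real (card {b \<in> E \<rightarrow>\<^sub>E UNIV. \<theta> * card E < card {e\<in>E. b e \<in> K e}}) \<le> (real CARD('c) * \<rho>) ^ card E"
    if fin: "finite E" and K: "\<And>e. e \<in> E \<Longrightarrow> real (card (K e)) = p * CARD('c)"
    for E :: "'e set" and K :: "'e \<Rightarrow> 'c set"
  proof -
    define B where "B = {b \<in> E \<rightarrow>\<^sub>E UNIV. \<theta> * card E < card {e\<in>E. b e \<in> K e}}"
    have finP: "finite (E \<rightarrow>\<^sub>E (UNIV :: 'c set))" using fin by (intro finite_PiE) auto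
    have "real (card B) * ((1 + \<eta>) powr \<theta>) ^ card E = (\<Sum>b\<in>B. (1 + \<eta>) powr (\<theta> * card E))"
      using \<eta> by (simp add: powr_powr[symmetric] powr_realpow)
    also have "\<dots> \<le> (\<Sum>b\<in>B. (1 + \<eta>) ^ card {e\<in>E. b e \<in> K e})"
      using \<eta> by (intro sum_mono) (auto simp: B_def powr_realpow[symmetric])
    also have "\<dots> \<le> (\<Sum>b\<in>E \<rightarrow>\<^sub>E UNIV. (1 + \<eta>) ^ card {e\<in>E. b e \<in> K e})"
      using \<eta> finP by (intro sum_mono2) (auto simp: B_def)
    also have "\<dots> = (\<Sum>b\<in>E \<rightarrow>\<^sub>E UNIV. \<Prod>e\<in>E. if b e \<in> K e then 1 + \<eta> else 1)"
      using fin by (intro sum.cong refl) (simp add: prod.If_cases Int_def)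
    also have "\<dots> = (\<Prod>e\<in>E. \<Sum>c\<in>UNIV. if c \<in> K e then 1 + \<eta> else 1)"
      using fin by (subst prod_sum_PiE) auto
    also have "\<dots> = (\<Prod>e\<in>E. real CARD('c) * (1 + p * \<eta>))"
    proof (rule prod.cong[OF refl])
      fix e assume e: "e \<in> E"
      have "(\<Sum>c\<in>UNIV. if c \<in> K e then 1 + \<eta> else 1) = (\<Sum>c\<in>UNIV. 1 + (if c \<in> K e then \<eta> else 0))"
        by (intro sum.cong) auto
      also have "\<dots> = real CARD('c) + real (card (K e)) * \<eta>"
        by (simp add: sum.distrib sum.If_cases)
      finally show "(\<Sum>c\<in>UNIV. if c \<in> K e then 1 + \<eta> else 1) = real CARD('c) * (1 + p * \<eta>)"
        using K[OF e] by (simp add: algebra_simps)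
    qed
    also have "\<dots> = (real CARD('c) * \<rho>) ^ card E * ((1 + \<eta>) powr \<theta>) ^ card E"
      using \<eta> by (simp add: \<rho>_def flip: power_mult_distrib)
    finally show ?thesis using \<eta> by (simp add: B_def)
  qed
  ultimately show thesis using that by blast
qed

section \<open>Instances with fixed scopes and variable shifts\<close>

text \<open>Only the shifts \<open>b\<close> vary. The order of each incidence list is chosen on the
  indices \<open>e\<close> before shifts are attached, so it carries no information on
  \<open>b\<close>.\<close>

definition scope_instance :: "'e set \<Rightarrow> ('e \<Rightarrow> nat ^ 'k::finite) \<Rightarrow> ('e \<Rightarrow> bit ^ 'k) \<Rightarrow> 'k csp" where
  "scope_instance E v b =
    \<lparr>constraints = (\<lambda>e. (v e, b e)) ` E,
     incidence = (\<lambda>x. map (\<lambda>e. (v e, b e))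
       (SOME es. distinct es \<and> set es = {e\<in>E. \<exists>j. v e $ j = x}))\<rparr>"

lemma constraint_vars_Pair: "constraint_vars (u, c) = range (($) u)"
  by (auto simp: constraint_vars_def)

lemma bounded_degree_scope_instance:
  assumes "finite E" and "inj_on v E" and "\<And>e j. e \<in> E \<Longrightarrow> v e $ j < n"
    and deg: "\<And>x. card {e\<in>E. \<exists>j. v e $ j = x} \<le> d"
  shows "bounded_degree_instance d n (scope_instance E v b)"
proof -
  define inc where "inc x = {e\<in>E. \<exists>j. v e $ j = x}" for x
  have inc: "{c \<in> (\<lambda>e. (v e, b e)) ` E. x \<in> constraint_vars c} = (\<lambda>e. (v e, b e)) ` inc x" for x
    by (auto simp: inc_def constraint_vars_Pair intro!: imageI)
  have "card ((\<lambda>e. (v e, b e)) ` inc x) \<le> d" for x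
    using card_image_le[of "inc x" "\<lambda>e. (v e, b e)"] deg[of x] \<open>finite E\<close>
    by (auto simp: inc_def intro: le_trans)
  moreover have "distinct (SOME es. distinct es \<and> set es = inc x) \<and> set (SOME es. distinct es \<and> set es = inc x) = inc x" for x
    using someI_ex[of "\<lambda>es. distinct es \<and> set es = inc x"] finite_distinct_list[of "inc x"] \<open>finite E\<close>
    by (auto simp: inc_def)
  moreover have "inj_on (\<lambda>e. (v e, b e)) (inc x)" for x
    using \<open>inj_on v E\<close> by (auto simp: inj_on_def inc_def)
  ultimately show ?thesis using assms(1,3)
    unfolding bounded_degree_instance_def
    by (auto simp: scope_instance_def inc inc_def[symmetric] distinct_map constraint_vars_Pair)
qed

text \<open>One \<open>loc\<close> serves all \<open>b\<close>: the query alone decides which index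
  is looked at, and the answer depends on \<open>b\<close> only through the shift of that
  index.\<close>

lemma csp_oracle_scope_instance:
  fixes v :: "'e \<Rightarrow> nat ^ 'k"
  assumes "finite E"
  obtains loc where "\<And>x i e. loc x i = Some e \<Longrightarrow> e \<in> E"
    and "\<And>b. csp_oracle (scope_instance E v b) = (\<lambda>x i. map_option (\<lambda>e. (v e, b e)) (loc x i))"
proof
  define es where "es x = (SOME es. distinct es \<and> set es = {e\<in>E. \<exists>j. v e $ j = x})" for x
  define loc where "loc x i =
    (if 1 \<le> i \<and> i \<le> length (es x) then Some (es x ! (i - 1)) else None)" for x i
  have es: "set (es x) = {e\<in>E. \<exists>j. v e $ j = x}" for x
    unfolding es_def using assms finite_distinct_list[of "{e\<in>E. \<exists>j. v e $ j = x}"]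
    by (rule_tac someI2_ex) auto
  show "e \<in> E" if "loc x i = Some e" for x i e
    using that es[of x] nth_mem[of "i - 1" "es x"] by (auto simp: loc_def split: if_splits)
  show "csp_oracle (scope_instance E v b) = (\<lambda>x i. map_option (\<lambda>e. (v e, b e)) (loc x i))" for b
    by (auto simp: csp_oracle_def scope_instance_def loc_def es_def[symmetric] fun_eq_iff)
qed

text \<open>Addition is subtraction over GF(2), so a constraint is a linear system in the assignment
  with right-hand side \<open>A *v c\<close>.\<close>

lemma holds_iff: "holds A \<sigma> (u, c) \<longleftrightarrow> A *v c = A *v (\<chi> j. \<sigma> (u $ j))"
proof -
  have "(\<chi> j. \<sigma> (u $ j) + c $ j) = (\<chi> j. \<sigma> (u $ j)) - c"
    by (simp add: vec_eq_iff)
  then show ?thesis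
    by (auto simp: holds_def pred_def matrix_vector_mult_diff_distrib)
qed

lemma satisfiable_scope_instance_iff:
  "satisfiable A (constraints (scope_instance E v b)) \<longleftrightarrow>
    (\<exists>\<sigma>. \<forall>e\<in>E. A *v b e = A *v (\<chi> j. \<sigma> (v e $ j)))"
  by (simp add: satisfiable_def scope_instance_def holds_iff)

section \<open>Counting satisfying shifts\<close>

lemma card_translated_kernel:
  "card {c. A *v c = A *v a} = card {c :: bit ^ 'k. A *v c = 0}"
  by (rule bij_betw_same_card[where f = "\<lambda>c. c - a"], rule bij_betw_byWitness[where f' = "\<lambda>c. c + a"])
    (auto simp: matrix_vector_mult_diff_distrib matrix_vector_right_distrib)

text \<open>The fibers of the surjection are translates of the kernel, hence equally large, and they
  partition the domain.\<close>

lemma card_kernel: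
  fixes A :: "bit ^ 'k ^ 'h"
  assumes "surj ((*v) A)"
  shows "card {c. A *v c = 0} * 2 ^ CARD('h) = 2 ^ CARD('k)"
proof -
  have fiber: "card {c. A *v c = y} = card {c. A *v c = 0}" for y
  proof -
    obtain a where "y = A *v a" using assms by (auto simp: surj_def)
    then show ?thesis by (simp add: card_translated_kernel)
  qed
  have "(\<Sum>y\<in>UNIV. card {c. A *v c = y}) = (\<Sum>y\<in>(UNIV :: (bit ^ 'h) set). card {c. A *v c = 0})"
    by (intro sum.cong refl fiber)
  then have "(\<Sum>y\<in>UNIV. card {c. A *v c = y}) = card {c. A *v c = 0} * CARD(bit ^ 'h)"
    by simp
  moreover have "(\<Sum>y\<in>UNIV. card {c. A *v c = y}) = CARD(bit ^ 'k)"
    using sum.group[of "UNIV :: (bit ^ 'k) set" UNIV "(*v) A" "\<lambda>_. 1::nat"] by simp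
  ultimately show ?thesis by (simp add: card_UNIV_bit)
qed

text \<open>An instance that is not far has an assignment satisfying more than a
  \<open>\<theta>\<close> fraction of the constraints. For a fixed assignment this is rare by
  \<open>\<rho>\<close>, and the union bound runs over the \<open>2 ^ n\<close> restrictions to the
  variables.\<close>

lemma few_scope_instances_not_far:
  fixes A :: "bit ^ 'k ^ 'h" and v :: "'e \<Rightarrow> nat ^ 'k" and \<epsilon> \<theta> \<alpha> :: real
  assumes fin: "finite E" and "inj_on v E" and less: "\<And>e j. e \<in> E \<Longrightarrow> v e $ j < n"
    and dn: "real d * real n = real CARD('k) * real (card E)"
    and \<rho>: "\<And>K :: 'e \<Rightarrow> (bit ^ 'k) set.
      (\<And>e. e \<in> E \<Longrightarrow> real (card (K e)) = real (card {c. A *v c = 0})) \<Longrightarrow>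
      real (card {b \<in> E \<rightarrow>\<^sub>E UNIV. \<theta> * card E < card {e\<in>E. b e \<in> K e}}) \<le> \<alpha>"
    and \<epsilon>: "\<epsilon> \<le> 1 - \<theta>"
  shows "real (card {b \<in> E \<rightarrow>\<^sub>E UNIV. \<not> far_from_satisfiable A d n \<epsilon> (scope_instance E v b)}) \<le> 2 ^ n * \<alpha>"
proof -
  define K where "K \<sigma> e = {c. A *v c = A *v (\<chi> j. \<sigma> (v e $ j))}" for \<sigma> e
  define B where "B \<sigma> = {b \<in> E \<rightarrow>\<^sub>E UNIV. \<theta> * card E < card {e\<in>E. b e \<in> K \<sigma> e}}" for \<sigma>
  have "{b \<in> E \<rightarrow>\<^sub>E UNIV. \<not> far_from_satisfiable A d n \<epsilon> (scope_instance E v b)}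
      \<subseteq> (\<Union>\<sigma>\<in>{..<n} \<rightarrow>\<^sub>E UNIV. B \<sigma>)"
  proof
    fix b assume b: "b \<in> {b \<in> E \<rightarrow>\<^sub>E UNIV. \<not> far_from_satisfiable A d n \<epsilon> (scope_instance E v b)}"
    define Cs where "Cs = constraints (scope_instance E v b)"
    have finCs: "finite Cs" using fin by (simp add: Cs_def scope_instance_def)
    obtain R \<sigma> where R: "R \<subseteq> Cs" "\<forall>c\<in>Cs - R. holds A \<sigma> c"
      and small: "card R < \<epsilon> * real d * real n / real CARD('k)"
      using b by (auto simp: far_from_satisfiable_def satisfiable_def Cs_def not_le)
    have small: "card R < \<epsilon> * card E"
    proof -
      have "\<epsilon> * real d * real n / real CARD('k) = \<epsilon> * card E"
        by (simp add: mult.assoc dn)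
      then show ?thesis using small by simp
    qed
    define \<tau> where "\<tau> = restrict \<sigma> {..<n}"
    have \<tau>: "(\<chi> j. \<tau> (v e $ j)) = (\<chi> j. \<sigma> (v e $ j))" if "e \<in> E" for e
      using less[OF that] by (simp add: \<tau>_def vec_eq_iff)
    have "E \<subseteq> {e\<in>E. b e \<in> K \<tau> e} \<union> {e\<in>E. (v e, b e) \<in> R}"
    proof
      fix e assume e: "e \<in> E"
      then have "(v e, b e) \<in> Cs" by (simp add: Cs_def scope_instance_def)
      then have "(v e, b e) \<in> R \<or> holds A \<sigma> (v e, b e)" using R(2) by blast
      then show "e \<in> {e\<in>E. b e \<in> K \<tau> e} \<union> {e\<in>E. (v e, b e) \<in> R}"
        using e by (auto simp: K_def \<tau> holds_iff)
    qed
    then have "card E \<le> card ({e\<in>E. b e \<in> K \<tau> e} \<union> {e\<in>E. (v e, b e) \<in> R})"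
      using fin by (intro card_mono) auto
    also have "\<dots> \<le> card {e\<in>E. b e \<in> K \<tau> e} + card {e\<in>E. (v e, b e) \<in> R}" by (rule card_Un_le)
    \<comment> \<open>Injectivity of \<open>v\<close> keeps constraints of different indices
      distinct, so \<open>R\<close> removes at most \<open>card R\<close> indices.\<close>
    also have "card {e\<in>E. (v e, b e) \<in> R} \<le> card R"
      using finite_subset[OF R(1) finCs] \<open>inj_on v E\<close>
      by (intro card_inj_on_le[where f = "\<lambda>e. (v e, b e)"]) (auto simp: inj_on_def)
    finally have "real (card E) < card {e\<in>E. b e \<in> K \<tau> e} + \<epsilon> * card E" using small by simp
    moreover have "\<epsilon> * card E \<le> (1 - \<theta>) * card E" using \<epsilon> by (intro mult_right_mono) auto
    ultimately have "\<theta> * card E < card {e\<in>E. b e \<in> K \<tau> e}" by (simp add: algebra_simps)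
    then have "b \<in> B \<tau>" using b by (simp add: B_def)
    moreover have "\<tau> \<in> {..<n} \<rightarrow>\<^sub>E UNIV" by (simp add: \<tau>_def)
    ultimately show "b \<in> (\<Union>\<sigma>\<in>{..<n} \<rightarrow>\<^sub>E UNIV. B \<sigma>)" by blast
  qed
  then have "card {b \<in> E \<rightarrow>\<^sub>E UNIV. \<not> far_from_satisfiable A d n \<epsilon> (scope_instance E v b)}
      \<le> card (\<Union>\<sigma>\<in>{..<n} \<rightarrow>\<^sub>E UNIV. B \<sigma>)"
  proof (rule card_mono[rotated])
    have "finite (E \<rightarrow>\<^sub>E (UNIV :: (bit ^ 'k) set))" using fin by (intro finite_PiE) auto
    then have "finite (B \<sigma>)" for \<sigma> by (rule rev_finite_subset) (auto simp: B_def)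
    then show "finite (\<Union>\<sigma>\<in>{..<n} \<rightarrow>\<^sub>E UNIV. B \<sigma>)" by (intro finite_UN_I finite_PiE) auto
  qed
  moreover have "real (card (\<Union>\<sigma>\<in>{..<n} \<rightarrow>\<^sub>E (UNIV :: bit set). B \<sigma>))
      \<le> real (card ({..<n} \<rightarrow>\<^sub>E (UNIV :: bit set))) * \<alpha>"
    unfolding B_def
    by (intro card_UN_le_mult \<rho>) (auto simp: K_def card_translated_kernel intro!: finite_PiE)
  ultimately show ?thesis by (simp add: card_PiE card_UNIV_bit)
qed

subsection \<open>The lower bound\<close>

theorem theorem9:
  fixes A :: "bit ^ 'k ^ 'h" and C :: "(bit ^ 'k) set" and r :: nat and \<epsilon> :: real
  assumes "CARD('k) \<ge> 3"
    and "2 ^ (r - 1) - 1 < CARD('k)" and "CARD('k) \<le> 2 ^ r - 1"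
    and "CARD('h) = CARD('k) - r"
    and "linear_code 3 C" and "vec.dim C = CARD('h)"
    and "vec.independent (rows A)" and "vec.span (rows A) = C"
    and "\<epsilon> > 0"
  shows "\<exists>d\<ge>1. \<forall>T :: nat \<Rightarrow> 'k algorithm.
           tester A d (1 - 2 * real CARD('k) / 2 ^ CARD('k) - \<epsilon>) T \<longrightarrow>
           (\<exists>c>0. \<forall>\<^sub>F n in sequentially.
              ereal (c * real n) \<le> ereal_of_enat (query_complexity d n (T n)))"
proof -
  have indep: "\<forall>i. c i = 0" if c: "(\<Sum>i\<in>UNIV. c i *s row i A) = 0" for c
    using rows_coefficients_zero[OF assms(7) _ c] assms(6,8) by simp
  have mem: "(\<Sum>i\<in>UNIV. c i *s row i A) \<in> C" for c
    unfolding assms(8)[symmetric]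
    by (intro vec.span_sum vec.span_scale vec.span_base) (auto simp: rows_def)

  \<comment> \<open>The fraction of satisfying inputs and the choice of constants\<close>
  define N where "N = real (card {c. A *v c = 0})"
  define p where "p = N / 2 ^ CARD('k)"
  have "p \<le> 2 * real CARD('k) / 2 ^ CARD('k)"
  proof -
    obtain B :: "bit ^ 'h ^ 'k" where B: "A ** B = mat 1"
    proof -
      have "\<exists>B :: bit ^ 'h ^ 'k. A ** B = mat 1"
        unfolding matrix_right_invertible_independent_rows
        by (intro allI impI) (rule indep[THEN spec])
      then show thesis using that by blast
    qed
    have "surj ((*v) A)"
      by (rule surjI[of _ "(*v) B"]) (simp add: matrix_vector_mul_assoc B)
    then have "card {c. A *v c = 0} * 2 ^ CARD('h) = 2 ^ CARD('k)" by (rule card_kernel)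
    \<comment> \<open>As \<open>CARD('h)\<close> is positive, the subtraction in
      \<open>CARD('k) - r\<close> is not truncated.\<close>
    moreover have "CARD('k) = r + CARD('h)"
      using assms(4) finite_UNIV_card_ge_0[where 'a = 'h] by simp
    ultimately have "card {c. A *v c = 0} = 2 ^ r" by (simp add: power_add)
    moreover have "r \<noteq> 0" using assms(1,3) by (cases r) auto
    then have "(2::nat) ^ r = 2 * 2 ^ (r - 1)" by (cases r) auto
    ultimately have "card {c. A *v c = 0} \<le> 2 * CARD('k)" using assms(2) by simp
    then have "N \<le> 2 * real CARD('k)" by (simp add: N_def)
    then show ?thesis unfolding p_def by (intro divide_right_mono) auto
  qed
  have p0: "0 \<le> p" by (simp add: p_def N_def)
  \<comment> \<open>Slack \<open>\<epsilon>\<close> above the satisfying fraction \<open>p\<close>;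
    the parameter of the tester is then at most \<open>1 - \<theta>\<close>.\<close>
  define \<theta> where "\<theta> = p + \<epsilon>"
  have "p < \<theta>" using assms(9) by (simp add: \<theta>_def)
  have Np: "N = p * CARD(bit ^ 'k)" by (simp add: p_def card_UNIV_bit)
  obtain \<rho> where \<rho>: "0 < \<rho>" "\<rho> < 1"
    and rare: "\<And>(E :: (nat \<times> nat) set) (K :: nat \<times> nat \<Rightarrow> (bit ^ 'k) set). finite E \<Longrightarrow>
      (\<And>e. e \<in> E \<Longrightarrow> real (card (K e)) = p * CARD(bit ^ 'k)) \<Longrightarrow>
      real (card {b \<in> E \<rightarrow>\<^sub>E UNIV. \<theta> * card E < card {e\<in>E. b e \<in> K e}})
        \<le> (real CARD(bit ^ 'k) * \<rho>) ^ card E"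
  proof (rule dense_choices_exponentially_rare[OF p0 \<open>p < \<theta>\<close>, where 'e = "nat \<times> nat" and 'c = "bit ^ 'k"], goal_cases)
    case (1 \<rho>)
    show ?case by (rule 1(1)[OF 1(2,3)]) (rule 1(4))
  qed
  \<comment> \<open>The bound 1/4 gives \<open>2 * (2 * \<rho> ^ D) < 1\<close>, which pays for the
    \<open>2 ^ n\<close> assignments and for the factor 2 in
    \<open>card Z \<le> 2 * card B\<close>.\<close>
  obtain D0 where D0: "\<rho> ^ D0 < 1 / 4" using \<rho> real_arch_pow_inv[of "1/4" \<rho>] by auto
  define D where "D = Suc D0"
  have D: "D \<ge> 1" "\<rho> ^ D < 1 / 4"
    using D0 \<rho> mult_strict_mono[of \<rho> 1 "\<rho> ^ D0" "1 / 4"] by (auto simp: D_def)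
  define d where "d = D * CARD('k)"
  obtain \<delta> :: real where \<delta>: "\<delta> > 0"
    and expander: "\<And>n. n \<ge> 1 \<Longrightarrow> \<exists>p. p permutes ({..<n} \<times> {..<D}) \<times> (UNIV :: 'k set) \<and>
          (\<forall>F \<subseteq> ({..<n} \<times> {..<D}) \<times> UNIV. F \<noteq> {} \<and> 3 * card (fst ` F) \<le> card F \<and>
            real (card (fst ` F)) \<le> \<delta> * real n \<longrightarrow> card F < 2 * card ((fst \<circ> fst \<circ> p) ` F))"
  proof (rule exists_expanding_permutation[OF D(1), where 'k = 'k], goal_cases)
    case (1 \<delta>)
    show ?case by (rule 1(1)[OF 1(2)]) (rule 1(3))
  qed
  \<comment> \<open>The condition \<open>2 \<le> \<delta> * n\<close> makes expansion available for
    pairs of scopes, which yields that the scopes are distinct.\<close>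
  have "ereal (\<delta> * real n) \<le> ereal_of_enat (query_complexity d n (T n))"
    if T: "tester A d (1 - 2 * real CARD('k) / 2 ^ CARD('k) - \<epsilon>) T" and n: "n \<ge> 1" "2 \<le> \<delta> * n"
    for T n
  proof (rule ccontr)
    assume contr: "\<not> ?thesis"
    then obtain q where q: "query_complexity d n (T n) = enat q" "real q < \<delta> * n"
      by (cases "query_complexity d n (T n)") auto
    define E where "E = {..<n} \<times> {..<D}"
    define X where "X = E \<times> (UNIV :: 'k set)"
    have fin: "finite E" "finite X" by (auto simp: E_def X_def)
    have cE: "card E = n * D" by (simp add: E_def)
    obtain \<pi> where \<pi>: "\<pi> permutes X"
      and expand: "\<And>F. F \<subseteq> X \<Longrightarrow> F \<noteq> {} \<Longrightarrow> 3 * card (fst ` F) \<le> card F \<Longrightarrow>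
        real (card (fst ` F)) \<le> \<delta> * real n \<Longrightarrow> card F < 2 * card ((fst \<circ> fst \<circ> \<pi>) ` F)"
      using expander[OF n(1)] unfolding X_def E_def by blast
    define v where "v e = (\<chi> j. fst (fst (\<pi> (e, j))))" for e
    have \<pi>X: "\<pi> (e, j) \<in> X" if "e \<in> E" for e j
      using permutes_in_image[OF \<pi>] that by (simp add: X_def)
    have less: "v e $ j < n" if "e \<in> E" for e j
      using \<pi>X[OF that, of j] by (auto simp: v_def X_def E_def)
    have var: "(\<lambda>(e, j). v e $ j) = fst \<circ> fst \<circ> \<pi>" by (auto simp: v_def)
    \<comment> \<open>Two equal scopes together contain each of their variables twice.\<close>
    have "inj_on v E"
    proof (rule inj_onI, rule ccontr)
      fix e e' assume e: "e \<in> E" "e' \<in> E" "v e = v e'" "e \<noteq> e'"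
      define F where "F = {e, e'} \<times> (UNIV :: 'k set)"
      have "card F = 2 * CARD('k)" "card (fst ` F) = 2"
        using e(4) by (auto simp: F_def card_cartesian_product fst_image_times)
      then have "card F < 2 * card ((fst \<circ> fst \<circ> \<pi>) ` F)"
        using e n assms(1) by (intro expand) (auto simp: F_def X_def)
      also have "(fst \<circ> fst \<circ> \<pi>) ` F = range (\<lambda>j. v e $ j)"
        using e(3) unfolding var[symmetric] F_def by (auto simp: image_iff)
      also have "card \<dots> \<le> CARD('k)" by (rule card_image_le) simp
      finally show False using \<open>card F = 2 * CARD('k)\<close> by simp
    qed
    have deg: "card {e\<in>E. \<exists>j. v e $ j = x} \<le> d" for x
    proof -
      define G where "G = {z\<in>X. fst (fst (\<pi> z)) = x}"
      have "{e\<in>E. \<exists>j. v e $ j = x} = fst ` G"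
        by (force simp: G_def X_def v_def)
      also have "card (fst ` G) \<le> card G" using fin by (intro card_image_le) (auto simp: G_def)
      also have "card G \<le> card (({x} \<times> {..<D}) \<times> (UNIV :: 'k set))"
      proof (rule card_inj_on_le)
        show "inj_on \<pi> G" using permutes_inj[OF \<pi>] by (rule inj_on_subset) simp
        show "\<pi> ` G \<subseteq> ({x} \<times> {..<D}) \<times> UNIV"
        proof
          fix w assume "w \<in> \<pi> ` G"
          then obtain z where "z \<in> X" "w = \<pi> z" "fst (fst w) = x" by (auto simp: G_def)
          then have "w \<in> X" "fst (fst w) = x" using permutes_in_image[OF \<pi>] by auto
          then show "w \<in> ({x} \<times> {..<D}) \<times> UNIV" by (auto simp: X_def E_def)
        qed
      qed simp
      also have "\<dots> = d" by (simp add: d_def card_cartesian_product)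
      finally show ?thesis .
    qed
    define I where "I = scope_instance E v"
    have I: "bounded_degree_instance d n (I b)" for b
      unfolding I_def using fin(1) \<open>inj_on v E\<close> less deg by (rule bounded_degree_scope_instance)
    obtain loc where loc: "\<And>x i e. loc x i = Some e \<Longrightarrow> e \<in> E"
      and orc: "\<And>b. csp_oracle (I b) = (\<lambda>x i. map_option (\<lambda>e. (v e, b e)) (loc x i))"
      unfolding I_def
    proof (rule csp_oracle_scope_instance[OF fin(1), of v], goal_cases)
      case (1 loc)
      show ?case by (rule 1(1)) (rule 1(2), assumption, rule 1(3))
    qed
    have queries: "num_queries t (csp_oracle (I b)) \<le> q" if t: "t \<in> set_pmf (T n)" for t b
    proof -
      have "enat (num_queries t (csp_oracle (I b))) \<le> query_complexity d n (T n)"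
        unfolding query_complexity_def using I t by (intro SUP_upper2[of "I b"] SUP_upper) auto
      then show ?thesis by (simp add: q)
    qed

    \<comment> \<open>Uniform shifts against uniform satisfiable shifts\<close>
    define Z where "Z = E \<rightarrow>\<^sub>E (UNIV :: (bit ^ 'k) set)"
    define Y where "Y = {b\<in>Z. satisfiable A (constraints (I b))}"
    have finZ: "finite Z" using fin by (auto simp: Z_def intro!: finite_PiE)
    have Y_iff: "b \<in> Y \<longleftrightarrow> b \<in> Z \<and> (\<exists>\<sigma>. \<forall>e\<in>E. A *v b e = A *v (\<chi> j. \<sigma> (v e $ j)))" for b
      by (simp add: Y_def I_def satisfiable_scope_instance_iff)
    have finY: "finite Y" using finZ by (simp add: Y_def)
    have closed: "(\<lambda>e\<in>E. a e - b e + c e) \<in> Y" if abc: "a \<in> Y" "b \<in> Y" "c \<in> Y" for a b c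
    proof -
      obtain \<sigma> \<tau> \<upsilon> where s: "\<forall>e\<in>E. A *v a e = A *v (\<chi> j. \<sigma> (v e $ j))"
        "\<forall>e\<in>E. A *v b e = A *v (\<chi> j. \<tau> (v e $ j))" "\<forall>e\<in>E. A *v c e = A *v (\<chi> j. \<upsilon> (v e $ j))"
        using abc unfolding Y_iff by auto
      have "(\<chi> j. \<sigma> (v e $ j) - \<tau> (v e $ j) + \<upsilon> (v e $ j))
          = (\<chi> j. \<sigma> (v e $ j)) - (\<chi> j. \<tau> (v e $ j)) + (\<chi> j. \<upsilon> (v e $ j))" for e
        by (simp add: vec_eq_iff)
      then have "\<forall>e\<in>E. A *v (a e - b e + c e) = A *v (\<chi> j. \<sigma> (v e $ j) - \<tau> (v e $ j) + \<upsilon> (v e $ j))"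
        using s by (simp add: matrix_vector_mult_diff_distrib matrix_vector_right_distrib del: add_bit_eq_xor minus_bit_def)
      then show ?thesis unfolding Y_iff Z_def
        by (auto intro!: exI[of _ "\<lambda>x. \<sigma> x - \<tau> x + \<upsilon> x"] simp del: add_bit_eq_xor minus_bit_def)
    qed
    have onto: "\<exists>b\<in>Y. \<forall>e\<in>S. b e = \<beta> e" if S: "S \<subseteq> E" "card S \<le> q" for S \<beta>
    proof -
      have finS: "finite S" using S fin finite_subset by blast
      have "\<exists>\<sigma>. \<forall>e\<in>S. A *v (\<chi> j. \<sigma> (v e $ j)) = A *v \<beta> e"
      proof (rule scopes_system_solvable[OF assms(5) indep mem finS])
        show "v e $ j < n" if "e \<in> S" for e j
          using that S by (intro less) auto
        fix F assume F: "F \<subseteq> S \<times> (UNIV :: 'k set)" "F \<noteq> {}" "3 * card (fst ` F) \<le> card F"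
        have "card (fst ` F) \<le> card S" using F finS by (intro card_mono) auto
        then have "real (card (fst ` F)) \<le> \<delta> * real n" using S q by linarith
        then show "card F < 2 * card ((\<lambda>(e, j). v e $ j) ` F)"
          unfolding var using F S by (intro expand) (auto simp: X_def)
      qed
      then obtain \<sigma> where \<sigma>: "\<forall>e\<in>S. A *v (\<chi> j. \<sigma> (v e $ j)) = A *v \<beta> e" by blast
      \<comment> \<open>Outside \<open>S\<close> each shift equals the values of
        \<open>\<sigma>\<close> on its scope, so the shifted input is zero and the constraint
        holds.\<close>
      define b where "b = (\<lambda>e\<in>E. if e \<in> S then \<beta> e else (\<chi> j. \<sigma> (v e $ j)))"
      have "b \<in> Y" unfolding Y_iff Z_def using \<sigma> by (auto simp: b_def intro!: exI[of _ \<sigma>])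
      moreover have "\<forall>e\<in>S. b e = \<beta> e" using S by (auto simp: b_def)
      ultimately show ?thesis by blast
    qed
    have local: "card {b\<in>Y. \<forall>e\<in>S. b e = \<beta> e} * card Z = card {b\<in>Z. \<forall>e\<in>S. b e = \<beta> e} * card Y"
      if S: "S \<subseteq> E" "card S \<le> q" for S \<beta>
    proof -
      have Yc: "card {b\<in>Y. \<forall>e\<in>S. b e = \<beta> e} * CARD(bit ^ 'k) ^ card S = card Y"
        using closed onto[OF S] fin S by (intro card_fiber_mult) (auto simp: Y_def Z_def)
      have Zc: "card {b\<in>Z. \<forall>e\<in>S. b e = \<beta> e} * CARD(bit ^ 'k) ^ card S = card Z"
      proof (rule card_fiber_mult[OF _ fin(1) S(1)])
        show "\<exists>b\<in>Z. \<forall>e\<in>S. b e = \<beta> e" for \<beta> using onto[OF S, of \<beta>] by (auto simp: Y_def)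
      qed (auto simp: Z_def)
      show ?thesis unfolding Yc[symmetric] Zc[symmetric] by simp
    qed

    \<comment> \<open>Counting shifts that are not far from satisfiable\<close>
    define B where "B = {b\<in>Z. \<not> far_from_satisfiable A d n (1 - 2 * real CARD('k) / 2 ^ CARD('k) - \<epsilon>) (I b)}"
    have ZB: "card Z \<le> 2 * card B"
    proof (rule satisfiable_and_far_indistinguishable[OF finY finZ, where orc = "\<lambda>b. csp_oracle (I b)" and M = "T n"])
      show "Y \<noteq> {}" using onto[of "{}"] by auto
      show "B \<subseteq> Z" by (auto simp: B_def)
      show "card {b\<in>Y. accepts t (csp_oracle (I b))} * card Z = card {b\<in>Z. accepts t (csp_oracle (I b))} * card Y"
        if "t \<in> set_pmf (T n)" for t
      proof -
        \<comment> \<open>Initially no shift is revealed; the vacuous condition gives the shape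
          required by \<open>card_accepts_local\<close>, with \<open>undefined\<close> as an
          arbitrary pattern.\<close>
        have "card {b\<in>Y. (\<forall>e\<in>{}. b e = undefined) \<and> accepts t (csp_oracle (I b))} * card Z =
            card {b\<in>Z. (\<forall>e\<in>{}. b e = undefined) \<and> accepts t (csp_oracle (I b))} * card Y"
          unfolding orc
        proof (rule card_accepts_local[OF finY finZ, where q = q and E = E and S = "{}"])
          show "num_queries t (\<lambda>x i. map_option (\<lambda>e. (v e, b e)) (loc x i)) + card {} \<le> q" for b
            using queries[OF that, of b] unfolding orc by simp
        qed (auto intro: loc local)
        then show ?thesis by simp
      qed
      show "measure_pmf.prob (T n) {t. accepts t (csp_oracle (I b))} \<ge> 2 / 3" if "b \<in> Y" for b
        using T n(1) I that unfolding tester_def Y_def by blast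
      show "measure_pmf.prob (T n) {t. \<not> accepts t (csp_oracle (I b))} \<ge> 2 / 3" if "b \<in> Z - B" for b
        using T n(1) I that unfolding tester_def B_def by blast
    qed
    have BE: "real (card B) \<le> 2 ^ n * (real CARD(bit ^ 'k) * \<rho>) ^ card E"
      unfolding B_def Z_def I_def
    proof (rule few_scope_instances_not_far[OF fin(1) \<open>inj_on v E\<close> less, where \<theta> = \<theta>])
      show "real d * real n = real CARD('k) * real (card E)" by (simp add: d_def cE)
      show "1 - 2 * real CARD('k) / 2 ^ CARD('k) - \<epsilon> \<le> 1 - \<theta>"
        using \<open>p \<le> _\<close> by (simp add: \<theta>_def)
    qed (use rare[OF fin(1)] Np in \<open>auto simp: N_def\<close>)
    have "real CARD(bit ^ 'k) ^ card E * 1 = real (card Z)"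
      using fin by (simp add: Z_def card_PiE)
    also have "\<dots> \<le> 2 * real (card B)" using ZB by linarith
    also have "\<dots> \<le> 2 * (2 ^ n * (real CARD(bit ^ 'k) * \<rho>) ^ card E)" using BE by linarith
    also have "\<dots> = real CARD(bit ^ 'k) ^ card E * (2 * 2 ^ n * \<rho> ^ card E)"
      by (simp only: power_mult_distrib mult_ac)
    finally have "real CARD(bit ^ 'k) ^ card E * 1 \<le> real CARD(bit ^ 'k) ^ card E * (2 * 2 ^ n * \<rho> ^ card E)" .
    then have "1 \<le> 2 * 2 ^ n * \<rho> ^ card E"
      by (rule mult_left_le_imp_le) simp
    also have "\<dots> = 2 * (2 * \<rho> ^ D) ^ n" by (simp add: cE power_mult_distrib power_mult mult.commute[of n])
    \<comment> \<open>\<open>2 * \<rho> ^ D\<close> is below 1, so \<open>n = 1\<close> is the worst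
      case.\<close>
    also have "\<dots> \<le> 2 * (2 * \<rho> ^ D) ^ 1"
      using n \<rho> D by (intro mult_left_mono power_decreasing) auto
    also have "\<dots> < 1" using D by simp
    finally show False by simp
  qed
  moreover have "\<forall>\<^sub>F n in sequentially. n \<ge> 1 \<and> 2 \<le> \<delta> * real n"
  proof -
    obtain m where "2 / \<delta> \<le> real m" using real_arch_simple by blast
    then show ?thesis using \<delta>
      by (intro eventually_sequentiallyI[of "max 1 m"]) (auto simp: field_simps, smt (verit) mult_left_mono of_nat_le_iff)
  qed
  moreover have "d \<ge> 1" using D assms(1) by (simp add: d_def)
  \<comment> \<open>The constant \<open>\<delta>\<close> serves as \<open>c\<close> for every
    tester, since it was fixed before \<open>T\<close>.\<close>
  ultimately show ?thesis using \<delta>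
    by (intro exI[of _ d] conjI allI impI exI[of _ \<delta>]) (auto elim!: eventually_mono)
qed

end
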